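(* Let $1\le d<n$ be integers, and let $\gamma\ge1$. Let $\mathcal{W}$ be the set of matrices $A=(\mathbf{a}^{(1)},\ldots,\mathbf{a}^{(d+1)})\in[0,1]^{(n-d)\times(d+1)}$ such that there are infinitely many $\mathbf{q}\in\mathbb{Z}^{n-d}$ for which \[ \max\{\|\mathbf{q}\cdot\mathbf{a}^{(1)}\|,\ldots,\|\mathbf{q}\cdot\mathbf{a}^{(d+1)}\|\}<H(\mathbf{q})^{-\sigma_1}, \] where $\sigma_1=\sigma_1(\mathbf{q})$ and $\sigma_2=\sigma_2(\mathbf{q})$ are given by \[ |\mathbf{q}|=H(\mathbf{q})^{\sigma_2},\qquad \sigma_1=\gamma(1+d\sigma_2). \] Then \[ \dim_{\mathrm{H}}(\mathcal{W})=(d+1)(n-d-1)+\frac{d+2}{1+\gamma(d+1)}\le(n-d)(d+1)-d. \]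
   Context: $\|x\|$ denotes the distance from $x\in\mathbb{R}$ to the nearest integer; $\mathbf{a}^{(j)}\in[0,1]^{n-d}$ are the columns of $A$. For $\mathbf{q}\in\mathbb{Z}^{k}$, $|\mathbf{q}|=\max_j|q_j|$ and $H(\mathbf{q})=\prod_{j\le k}\max\{1,|q_j|\}$. The finitely many $\mathbf{q}$ with $H(\mathbf{q})=1$ (for which $\sigma_2$ is not determined) are irrelevant; otherwise $H(\mathbf{q})^{-\sigma_1}=H(\mathbf{q})^{-\gamma}|\mathbf{q}|^{-\gamma d}$. $\dim_{\mathrm{H}}$ is Hausdorff dimension. *)

theory Defs
  imports "HOL-Analysis.Analysis"
begin

(* The s-th power of the diameter as it enters Hausdorff measures: the empty set
   contributes 0, and a nonempty set contributes 1 when s = 0 (whereas 0 powr 0 = 0). *)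
definition diam_power :: "real \<Rightarrow> 'a::metric_space set \<Rightarrow> ennreal" where
  "diam_power s U = (if U = {} then 0 else if s = 0 then 1 else ennreal (diameter U powr s))"

(* Covers are indexed by nat; finite covers are included by padding with empty sets.
   Boundedness is required explicitly because the real-valued diameter is only
   meaningful for bounded sets. *)
definition hausdorff_premeasure :: "real \<Rightarrow> real \<Rightarrow> 'a::metric_space set \<Rightarrow> ennreal" where
  "hausdorff_premeasure s \<delta> E =
     (INF U \<in> {U :: nat \<Rightarrow> 'a set. E \<subseteq> (\<Union>i. U i) \<and>
                (\<forall>i. bounded (U i) \<and> diameter (U i) \<le> \<delta>)}.
        (\<Sum>i. diam_power s (U i)))"

definition hausdorff_measure :: "real \<Rightarrow> 'a::metric_space set \<Rightarrow> ennreal" where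
  "hausdorff_measure s E = (SUP \<delta>\<in>{0<..}. hausdorff_premeasure s \<delta> E)"

definition hausdorff_dim :: "'a::metric_space set \<Rightarrow> ereal" where
  "hausdorff_dim E = Inf {ereal s | s. 0 \<le> s \<and> hausdorff_measure s E = 0}"

definition dist_nearest_int :: "real \<Rightarrow> real" where
  "dist_nearest_int x = \<bar>x - of_int (round x)\<bar>"

definition max_abs :: "int^'k \<Rightarrow> real" where
  "max_abs q = Max (range (\<lambda>j. real_of_int \<bar>q $ j\<bar>))"

definition height :: "int^'k \<Rightarrow> real" where
  "height q = (\<Prod>j\<in>UNIV. max 1 (real_of_int \<bar>q $ j\<bar>))"

(* A matrix of type real^'c^'r has rows indexed by 'r and columns by 'c; in the intended use
   CARD('r) = n - d and CARD('c) = d + 1.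
   The exponents are given by their defining equations.  These determine them uniquely if
   height q \<noteq> 1; the finitely many q with height q = 1 do not affect the infinitude. *)
definition approximable_matrices :: "nat \<Rightarrow> real \<Rightarrow> (real^'c^'r) set" where
  "approximable_matrices d \<gamma> =
     {A. (\<forall>i j. A $ i $ j \<in> {0..1}) \<and>
         infinite {q :: int^'r. \<exists>\<sigma>\<^sub>1 \<sigma>\<^sub>2.
           max_abs q = height q powr \<sigma>\<^sub>2 \<and>
           \<sigma>\<^sub>1 = \<gamma> * (1 + real d * \<sigma>\<^sub>2) \<and>
           Max (range (\<lambda>j. dist_nearest_int ((\<chi> i. real_of_int (q $ i)) \<bullet> column j A)))
             < height q powr (- \<sigma>\<^sub>1)}}"

end

theory Submission
  imports Defs
begin

text \<open>Write \<open>m = n - d\<close> for the number of rows and \<open>N = d + 1\<close> for the number of columns. Eliminating the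
exponents, the condition on \<open>q\<close> says that all columns have scalar product with \<open>q\<close> within
\<open>\<psi>(q) = H(q)\<^bsup>-\<gamma>\<^esup> \<bar>q\<bar>\<^bsup>-\<gamma>d\<^esup>\<close> of an integer.

Upper bound. For fixed \<open>q\<close> the columns lie in neighbourhoods of width \<open>\<delta> = \<psi>(q) / \<bar>q\<bar>\<close> of \<open>O(\<bar>q\<bar>)\<close>
parallel hyperplanes, so the matrices are covered by \<open>O(\<bar>q\<bar>\<^sup>N \<delta>\<^bsup>-(m-1)N\<^esup>)\<close> cells of mesh \<open>\<delta>\<close>
(\<open>card_near_integer_cells\<close>). With \<open>t = s - (m - 1) N\<close> the Hausdorff sum becomes \<open>\<Sum> \<bar>q\<bar>\<^sup>N \<delta>\<^sup>t\<close>. For \<open>t\<close> above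
\<open>(d + 2) / (1 + \<gamma> (d + 1))\<close>, the inequalities \<open>\<gamma> t \<ge> 1\<close> (from \<open>\<gamma> \<ge> 1\<close>) and \<open>\<bar>q\<bar> \<le> H(q) \<le> \<bar>q\<bar>\<^sup>m\<close> bound the
terms by \<open>H(q)\<^bsup>-1-\<eta>/m\<^esup>\<close> with \<open>\<eta> > 0\<close> (\<open>exponent_estimate\<close>), which is summable because the height is a product
over the coordinates.

Lower bound. The vectors \<open>q\<close> supported on a single coordinate already give the full dimension: they ask
for simultaneous approximation of one row in \<open>\<real>\<^sup>N\<close> with exponent \<open>\<tau> = \<gamma> (d + 1)\<close>, and leave the
other \<open>(m - 1) N\<close> entries free. For such rows a theorem of Jarnik gives the dimension
\<open>(N + 1) / (1 + \<tau>)\<close>. It is proved here by constructing, for a cover whose sum of \<open>s\<close>-th powers is too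
small, an approximable point outside of it: nested cubes around fractions are chosen such that the part of
the cover which meets them stays small relative to the cube (\<open>child_cube\<close>). The supply of fractions comes
from Dirichlet's theorem (\<open>well_spaced_rationals\<close>). The free entries are added by integrating this estimate over
the slices of a cover of the matrix set (\<open>cover_sum_lower_bound\<close>).\<close>

section \<open>Cubes and integer points\<close>

definition cube :: "real^'c \<Rightarrow> real \<Rightarrow> (real^'c) set" where
  "cube z r = {x. \<forall>j. \<bar>x $ j - z $ j\<bar> \<le> r}"

lemma cube_eq_cbox: "cube z r = cbox (\<chi> j. z $ j - r) (\<chi> j. z $ j + r)"
  by (auto simp: cube_def mem_box_cart abs_le_iff algebra_simps)

lemma cube_sets [measurable, simp]: "cube z r \<in> sets borel"
  by (simp add: cube_eq_cbox)

lemma cube_fmeasurable [simp]: "cube z r \<in> fmeasurable lborel"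
  by (simp add: cube_eq_cbox)

lemma measure_cube:
  fixes z :: "real^'c"
  assumes "r \<ge> 0"
  shows "measure lborel (cube z r) = (2 * r) ^ CARD('c)"
proof -
  have "cbox (\<chi> j. z $ j - r) (\<chi> j. z $ j + r) \<noteq> {}"
    using assms by (auto simp: interval_ne_empty_cart)
  then show ?thesis
    unfolding cube_eq_cbox by (subst content_cbox_cart) auto
qed

lemma cube_trans:
  assumes "x \<in> cube y r" "y \<in> cube z s"
  shows "x \<in> cube z (r + s)"
  unfolding cube_def
proof (intro CollectI allI)
  fix j
  have "\<bar>x $ j - y $ j\<bar> \<le> r" "\<bar>y $ j - z $ j\<bar> \<le> s"
    using assms by (auto simp: cube_def)
  then show "\<bar>x $ j - z $ j\<bar> \<le> r + s" by linarith
qed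

lemma cube_mono: "r \<le> s \<Longrightarrow> cube z r \<subseteq> cube z s"
  unfolding cube_def by (auto intro: order.trans)

lemma card_vec_coords:
  fixes S :: "'c::finite \<Rightarrow> 'a set"
  assumes "\<And>j. finite (S j)"
  shows "finite {v::'a^'c. \<forall>j. v $ j \<in> S j}"
    and "card {v::'a^'c. \<forall>j. v $ j \<in> S j} = (\<Prod>j\<in>UNIV. card (S j))"
proof -
  let ?V = "{v::'a^'c. \<forall>j. v $ j \<in> S j}"
  have bij: "bij_betw vec_lambda (\<Pi>\<^sub>E j\<in>UNIV. S j) ?V"
    by (rule bij_betwI[where g = vec_nth]) (auto simp: PiE_def Pi_def vec_lambda_eta)
  have "finite (\<Pi>\<^sub>E j\<in>UNIV. S j)" using assms by (intro finite_PiE) auto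
  with bij show "finite ?V" using bij_betw_finite by blast
  show "card ?V = (\<Prod>j\<in>UNIV. card (S j))"
    using bij_betw_same_card[OF bij] by (simp add: card_PiE)
qed

lemma card_int_near:
  fixes a w :: real
  assumes "w \<ge> 0"
  shows "finite {k::int. \<bar>of_int k - a\<bar> \<le> w}"
    and "real (card {k::int. \<bar>of_int k - a\<bar> \<le> w}) \<le> 2 * w + 1"
proof -
  have eq: "{k::int. \<bar>of_int k - a\<bar> \<le> w} = {\<lceil>a - w\<rceil>..\<lfloor>a + w\<rfloor>}"
    by (auto simp: ceiling_le_iff le_floor_iff abs_le_iff)
  show "finite {k::int. \<bar>of_int k - a\<bar> \<le> w}" unfolding eq by simp
  have "of_int (\<lfloor>a + w\<rfloor> - \<lceil>a - w\<rceil> + 1) \<le> 2 * w + 1"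
    using of_int_floor_le[of "a + w"] le_of_int_ceiling[of "a - w"]
    unfolding of_int_add of_int_diff of_int_1 by linarith
  then show "real (card {k::int. \<bar>of_int k - a\<bar> \<le> w}) \<le> 2 * w + 1"
    unfolding eq using assms by simp
qed

lemma card_int_vec_near:
  fixes a :: "real^'c"
  assumes "w \<ge> 0"
  shows "finite {v::int^'c. \<forall>j. \<bar>of_int (v $ j) - a $ j\<bar> \<le> w}"
    and "real (card {v::int^'c. \<forall>j. \<bar>of_int (v $ j) - a $ j\<bar> \<le> w}) \<le> (2 * w + 1) ^ CARD('c)"
proof -
  let ?S = "\<lambda>j. {k::int. \<bar>of_int k - a $ j\<bar> \<le> w}"
  have eq: "{v::int^'c. \<forall>j. \<bar>of_int (v $ j) - a $ j\<bar> \<le> w} = {v. \<forall>j. v $ j \<in> ?S j}" by auto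
  have fin: "\<And>j. finite (?S j)" using card_int_near(1)[OF assms] by blast
  show "finite {v::int^'c. \<forall>j. \<bar>of_int (v $ j) - a $ j\<bar> \<le> w}"
    unfolding eq by (rule card_vec_coords(1)[OF fin])
  have "real (card {v::int^'c. \<forall>j. v $ j \<in> ?S j}) = (\<Prod>j\<in>UNIV. real (card (?S j)))"
    by (subst card_vec_coords(2)[OF fin]) simp
  also have "\<dots> \<le> (\<Prod>j\<in>(UNIV::'c set). 2 * w + 1)"
    by (intro prod_mono) (use card_int_near(2)[OF assms] in auto)
  finally show "real (card {v::int^'c. \<forall>j. \<bar>of_int (v $ j) - a $ j\<bar> \<le> w}) \<le> (2 * w + 1) ^ CARD('c)"
    unfolding eq by simp
qed

definition separated :: "real \<Rightarrow> (real^'c) set \<Rightarrow> bool" where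
  "separated \<kappa> X \<longleftrightarrow> (\<forall>x\<in>X. \<forall>y\<in>X. x \<noteq> y \<longrightarrow> (\<exists>j. \<kappa> \<le> \<bar>x $ j - y $ j\<bar>))"

text \<open>Rounding to the grid of mesh \<open>\<kappa>\<close> is injective on a \<open>\<kappa>\<close>-separated set, because two points in
one half-open grid cell differ by less than \<open>\<kappa>\<close> in every coordinate. So the points are counted by
grid cells.\<close>

lemma card_separated_in_cube:
  fixes X :: "(real^'c) set"
  assumes "\<kappa> > 0" "r \<ge> 0" and sep: "separated \<kappa> X" and X: "X \<subseteq> cube z r"
  shows "finite X" and "real (card X) \<le> (2 * r / \<kappa> + 2) ^ CARD('c)"
proof -
  let ?f = "\<lambda>x::real^'c. (\<chi> j. \<lfloor>x $ j / \<kappa>\<rfloor>) :: int^'c"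
  \<comment> \<open>The centre is shifted by one half since a floor lies in \<open>(y - 1, y]\<close>, an interval centred at \<open>y - 1/2\<close>.\<close>
  let ?a = "(\<chi> j. z $ j / \<kappa> - 1/2) :: real^'c"
  let ?w = "r / \<kappa> + 1/2"
  let ?V = "{v::int^'c. \<forall>j. \<bar>of_int (v $ j) - ?a $ j\<bar> \<le> ?w}"
  have w: "?w \<ge> 0" using assms by (simp add: add_nonneg_nonneg)
  have inj: "inj_on ?f X"
  proof (rule inj_onI, rule ccontr)
    fix x y assume x: "x \<in> X" and y: "y \<in> X" and eq: "?f x = ?f y" and "x \<noteq> y"
    then obtain j where j: "\<kappa> \<le> \<bar>x $ j - y $ j\<bar>" using sep by (auto simp: separated_def)
    have "\<lfloor>x $ j / \<kappa>\<rfloor> = \<lfloor>y $ j / \<kappa>\<rfloor>" using eq by (simp add: vec_eq_iff)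
    then have "\<bar>x $ j / \<kappa> - y $ j / \<kappa>\<bar> < 1" by linarith
    moreover have "\<bar>x $ j / \<kappa> - y $ j / \<kappa>\<bar> = \<bar>x $ j - y $ j\<bar> / \<kappa>"
      using assms(1) by (simp add: diff_divide_distrib[symmetric])
    ultimately show False using j assms(1) by (simp add: field_simps)
  qed
  have sub: "?f ` X \<subseteq> ?V"
  proof safe
    fix x j assume "x \<in> X"
    then have "\<bar>x $ j - z $ j\<bar> \<le> r" using X by (auto simp: cube_def)
    then have "\<bar>x $ j / \<kappa> - z $ j / \<kappa>\<bar> \<le> r / \<kappa>"
      using assms(1) by (simp add: diff_divide_distrib[symmetric] divide_right_mono)
    then have "\<bar>of_int \<lfloor>x $ j / \<kappa>\<rfloor> - (z $ j / \<kappa> - 1/2)\<bar> \<le> r / \<kappa> + 1/2"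
      using floor_correct[of "x $ j / \<kappa>"] by linarith
    then show "\<bar>of_int (?f x $ j) - ?a $ j\<bar> \<le> ?w" by simp
  qed
  show "finite X"
    using card_int_vec_near(1)[OF w, of ?a] sub inj by (meson finite_imageD finite_subset)
  have "real (card X) = real (card (?f ` X))" by (simp add: card_image[OF inj])
  also have "\<dots> \<le> real (card ?V)"
    using card_mono[OF card_int_vec_near(1)[OF w, of ?a] sub] by linarith
  also have "\<dots> \<le> (2 * ?w + 1) ^ CARD('c)" by (rule card_int_vec_near(2)[OF w])
  finally show "real (card X) \<le> (2 * r / \<kappa> + 2) ^ CARD('c)"
    by (simp add: add.commute)
qed

text \<open>A separated subset with the largest number of elements cannot be enlarged, so every point of
\<open>R\<close> is within \<open>\<kappa>\<close> of it.\<close>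

lemma maximal_separated_subset:
  fixes R :: "(real^'c) set"
  assumes "finite R"
  obtains X where "X \<subseteq> R" "separated \<kappa> X" "\<And>x. x \<in> R \<Longrightarrow> \<kappa> > 0 \<Longrightarrow> \<exists>y\<in>X. x \<in> cube y \<kappa>"
proof -
  let ?P = "\<lambda>X. X \<subseteq> R \<and> separated \<kappa> X"
  have "?P {}" by (simp add: separated_def)
  moreover have "\<forall>X. ?P X \<longrightarrow> card X < Suc (card R)"
    using assms card_mono by (metis less_Suc_eq_le)
  ultimately obtain X where X: "?P X" and max: "\<And>Y. ?P Y \<Longrightarrow> card Y \<le> card X"
    using ex_has_greatest_nat[of ?P "{}" card "Suc (card R)"] by (metis less_imp_le)
  show thesis
  proof (rule that)
    show "X \<subseteq> R" "separated \<kappa> X" using X by auto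
    fix x assume x: "x \<in> R" and k: "\<kappa> > 0"
    show "\<exists>y\<in>X. x \<in> cube y \<kappa>"
    proof (rule ccontr)
      assume neg: "\<not> (\<exists>y\<in>X. x \<in> cube y \<kappa>)"
      then have far: "\<exists>j. \<kappa> \<le> \<bar>x $ j - y $ j\<bar>" if "y \<in> X" for y
        using that by (auto simp: cube_def not_le intro: less_imp_le)
      have "x \<notin> X" using neg k by (auto simp: cube_def)
      have "separated \<kappa> (insert x X)"
        using X far by (auto simp: separated_def abs_minus_commute)
      then have "card (insert x X) \<le> card X" using max X x by auto
      moreover have "finite X" using X assms finite_subset by blast
      ultimately show False using \<open>x \<notin> X\<close> by simp
    qed
  qed
qed

section \<open>Well-spaced rational points\<close>

definition rat_point :: "int^'c \<Rightarrow> nat \<Rightarrow> real^'c" where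
  "rat_point p q = (\<chi> j. of_int (p $ j) / real q)"

lemma rat_point_diff:
  assumes "q > 0"
  shows "\<bar>rat_point p q $ j - a\<bar> = \<bar>real q * a - of_int (p $ j)\<bar> / real q"
proof -
  have "rat_point p q $ j - a = - ((real q * a - of_int (p $ j)) / real q)"
    using assms by (simp add: rat_point_def field_simps)
  then show ?thesis by simp
qed

lemma dirichlet_vec:
  fixes x :: "real^'c"
  assumes "K > 0"
  obtains q :: nat and p :: "int^'c" where "0 < q" "q \<le> K ^ CARD('c)"
    "\<And>j. \<bar>real q * x $ j - of_int (p $ j)\<bar> < 1 / real K"
proof -
  obtain h where h: "bij_betw h {0..<CARD('c)} (UNIV::'c set)"
    using ex_bij_betw_nat_finite[of "UNIV::'c set"] by auto
  obtain q p where q: "0 < q" "q \<le> int (K ^ CARD('c))"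
    and qp: "\<And>i. i < CARD('c) \<Longrightarrow> \<bar>of_int q * x $ h i - of_int (p i)\<bar> < 1 / real K"
    using Dirichlet_approx_simult[OF assms, of "CARD('c)" "\<lambda>i. x $ h i"] by blast
  let ?g = "inv_into {0..<CARD('c)} h"
  show thesis
  proof (rule that)
    show "0 < nat q" "nat q \<le> K ^ CARD('c)" using q by linarith+
    fix j
    have "?g j \<in> {0..<CARD('c)}" and gj: "h (?g j) = j"
      using h by (auto simp: bij_betw_def intro!: inv_into_into f_inv_into_f simp del: atLeastLessThan_iff)
    then have "\<bar>of_int q * x $ j - of_int (p (?g j))\<bar> < 1 / real K" using qp[of "?g j"] by simp
    then show "\<bar>real (nat q) * x $ j - of_int ((\<chi> j. p (?g j)) $ j)\<bar> < 1 / real K"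
      using q by simp
  qed
qed

text \<open>The points that Dirichlet's theorem with parameter \<open>K\<close> approximates by a fraction of denominator
at most \<open>n\<close>. The numerators are restricted to those that can serve a point of \<open>cube z \<sigma>\<close>, which makes
the union finite.\<close>

definition near_small_denominator :: "real^'c \<Rightarrow> real \<Rightarrow> nat \<Rightarrow> nat \<Rightarrow> (real^'c) set" where
  "near_small_denominator z \<sigma> K n =
     (\<Union>q\<in>{1..n}. \<Union>p\<in>{p. \<forall>j. \<bar>of_int (p $ j) - (\<chi> j. real q * z $ j) $ j\<bar> \<le> real q * \<sigma> + 1}.
        cube (rat_point p q) (1 / (real q * real K)))"

text \<open>For a denominator \<open>q\<close> there are at most \<open>(2 \<sigma> q + 3)\<^sup>N\<close> numerators, each contributing volume
\<open>(2 / (q K))\<^sup>N\<close>. The main part \<open>(2 \<sigma> q)\<^sup>N\<close> gives a volume independent of \<open>q\<close>, whence the term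
proportional to \<open>n\<close>; the boundary term decays like \<open>1 / q\<^sup>N\<close> and is summable because \<open>N \<ge> 2\<close>.\<close>

lemma measure_near_small_denominator:
  fixes z :: "real^'c"
  assumes "\<sigma> > 0" "K > 0" and N: "CARD('c) \<ge> 2"
  shows "near_small_denominator z \<sigma> K n \<in> fmeasurable lborel"
    and "measure lborel (near_small_denominator z \<sigma> K n)
      \<le> (real n * (8 * \<sigma>) ^ CARD('c) + 12 ^ CARD('c) * (\<Sum>q. 1 / real q ^ 2)) / real K ^ CARD('c)"
proof -
  let ?N = "CARD('c)"
  let ?P = "\<lambda>q. {p::int^'c. \<forall>j. \<bar>of_int (p $ j) - (\<chi> j. real q * z $ j) $ j\<bar> \<le> real q * \<sigma> + 1}"
  let ?C = "\<lambda>q p::int^'c. cube (rat_point p q) (1 / (real q * real K))"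
  have nn: "real q * \<sigma> + 1 \<ge> 0" for q using assms by simp
  have fin: "finite (?P q)" for q using card_int_vec_near(1)[OF nn] .
  have fm: "(\<Union>p\<in>?P q. ?C q p) \<in> fmeasurable lborel" for q
    using fin by (intro fmeasurable.finite_UN) auto
  show "near_small_denominator z \<sigma> K n \<in> fmeasurable lborel"
    unfolding near_small_denominator_def by (rule fmeasurable.finite_UN, simp) (rule fm)
  have one: "measure lborel (\<Union>p\<in>?P q. ?C q p)
      \<le> ((8 * \<sigma>) ^ ?N + 12 ^ ?N * (1 / real q ^ 2)) / real K ^ ?N" if q: "q \<ge> 1" for q
  proof -
    have "measure lborel (\<Union>p\<in>?P q. ?C q p) \<le> (\<Sum>p\<in>?P q. measure lborel (?C q p))"
      using fin by (intro measure_UNION_le) auto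
    also have "\<dots> = real (card (?P q)) * (2 / (real q * real K)) ^ ?N"
      by (subst measure_cube) auto
    also have "\<dots> \<le> (2 * (real q * \<sigma> + 1) + 1) ^ ?N * (2 / (real q * real K)) ^ ?N"
      by (intro mult_right_mono card_int_vec_near(2)[OF nn]) auto
    also have "\<dots> = ((4 * \<sigma> + 6 / real q) / real K) ^ ?N"
    proof -
      have "(2 * (real q * \<sigma> + 1) + 1) * (2 / (real q * real K)) = (4 * \<sigma> + 6 / real q) / real K"
        using q assms by (simp add: field_simps)
      then show ?thesis by (simp only: power_mult_distrib[symmetric])
    qed
    also have "\<dots> = (4 * \<sigma> + 6 / real q) ^ ?N / real K ^ ?N" by (simp add: power_divide)
    also have "\<dots> \<le> ((8 * \<sigma>) ^ ?N + (12 / real q) ^ ?N) / real K ^ ?N"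
    proof (intro divide_right_mono)
      have "4 * \<sigma> + 6 / real q \<le> max (8 * \<sigma>) (12 / real q)" by linarith
      then have "(4 * \<sigma> + 6 / real q) ^ ?N \<le> max (8 * \<sigma>) (12 / real q) ^ ?N"
        using assms by (intro power_mono) auto
      also have "\<dots> \<le> (8 * \<sigma>) ^ ?N + (12 / real q) ^ ?N"
        using assms by (auto simp: max_def)
      finally show "(4 * \<sigma> + 6 / real q) ^ ?N \<le> (8 * \<sigma>) ^ ?N + (12 / real q) ^ ?N" .
    qed auto
    also have "\<dots> \<le> ((8 * \<sigma>) ^ ?N + 12 ^ ?N * (1 / real q ^ 2)) / real K ^ ?N"
    proof (intro divide_right_mono add_left_mono)
      have "real q ^ 2 \<le> real q ^ ?N" using q N by (intro power_increasing) auto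
      then have "1 / real q ^ ?N \<le> 1 / real q ^ 2" using q by (intro divide_left_mono) auto
      then have "12 ^ ?N * (1 / real q ^ ?N) \<le> 12 ^ ?N * (1 / real q ^ 2)" by (intro mult_left_mono) auto
      then show "(12 / real q) ^ ?N \<le> 12 ^ ?N * (1 / real q ^ 2)" by (simp add: power_divide)
    qed auto
    finally show ?thesis .
  qed
  have "measure lborel (near_small_denominator z \<sigma> K n)
      \<le> (\<Sum>q\<in>{1..n}. measure lborel (\<Union>p\<in>?P q. ?C q p))"
    unfolding near_small_denominator_def by (intro measure_UNION_le fmeasurableD fm) auto
  also have "\<dots> \<le> (\<Sum>q\<in>{1..n}. ((8 * \<sigma>) ^ ?N + 12 ^ ?N * (1 / real q ^ 2)) / real K ^ ?N)"
    by (intro sum_mono one) auto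
  also have "\<dots> = (real n * (8 * \<sigma>) ^ ?N + 12 ^ ?N * (\<Sum>q\<in>{1..n}. 1 / real q ^ 2)) / real K ^ ?N"
    unfolding sum_divide_distrib[symmetric] sum.distrib sum_distrib_left[symmetric] by simp
  also have "\<dots> \<le> (real n * (8 * \<sigma>) ^ ?N + 12 ^ ?N * (\<Sum>q. 1 / real q ^ 2)) / real K ^ ?N"
    using inverse_power_summable[of 2, where 'a = real]
    by (intro divide_right_mono add_left_mono mult_left_mono sum_le_suminf) (auto simp: divide_inverse)
  finally show "measure lborel (near_small_denominator z \<sigma> K n)
      \<le> (real n * (8 * \<sigma>) ^ ?N + 12 ^ ?N * (\<Sum>q. 1 / real q ^ 2)) / real K ^ ?N" .
qed

text \<open>The scale of the construction at parameter \<open>K\<close>: a point that Dirichlet's theorem approximates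
with a denominator \<open>q \<ge> K\<^sup>N / 4\<^bsup>N+1\<^esup>\<close> has distance at most \<open>1 / (q K) \<le> (4 / K)\<^bsup>N+1\<^esup>\<close> from that
fraction. Up to a constant this is the largest spacing that \<open>K\<^bsup>N(N+1)\<^esup>\<close> points of a unit cube can have, and there are
about that many fractions.\<close>

definition spacing :: "nat \<Rightarrow> nat \<Rightarrow> real" where
  "spacing N K = (4 / real K) ^ (N + 1)"

lemma powr_neg_nat: "K > 0 \<Longrightarrow> real K powr - real n = 1 / real K ^ n"
  by (simp only: powr_minus powr_realpow of_nat_0_less_iff inverse_eq_divide)

lemma spacing_powr: "K > 0 \<Longrightarrow> spacing N K = 4 ^ (N + 1) * real K powr - real (N + 1)"
  unfolding spacing_def powr_neg_nat power_divide by simp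

lemma tendsto_neg_powr_nat: "a < 0 \<Longrightarrow> (\<lambda>K. C * real K powr a) \<longlonglongrightarrow> 0"
  by (rule tendsto_mult_right_zero) (rule tendsto_neg_powr[OF _ filterlim_real_sequentially])

text \<open>Fractions with denominators comparable to \<open>K\<^sup>N\<close> are spread over every cube as evenly as their
number permits. By Dirichlet's theorem each point of the half-size cube is close to a fraction with
denominator at most \<open>K\<^sup>N\<close>; those served only by a denominator below \<open>K\<^sup>N / 4\<^bsup>N+1\<^esup>\<close> fill at most
half of the volume. The remaining fractions contain a maximal separated subset \<open>X\<close>, and since the cubes of
twice the spacing around \<open>X\<close> cover the other half of the volume, \<open>X\<close> must be large.\<close>

lemma well_spaced_rationals:
  fixes z :: "real^'c"
  assumes N: "CARD('c) \<ge> 2" and "\<rho> > 0"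
  shows "\<forall>\<^sub>F K in sequentially. \<exists>X. finite X \<and> X \<subseteq> cube z (\<rho> / 2 + spacing CARD('c) K)
      \<and> separated (spacing CARD('c) K) X
      \<and> (\<forall>x\<in>X. \<exists>q p. real K ^ CARD('c) / 4 ^ (CARD('c) + 1) \<le> real q \<and> q \<le> K ^ CARD('c) \<and> x = rat_point p q)
      \<and> \<rho> ^ CARD('c) \<le> 2 * (4 * spacing CARD('c) K) ^ CARD('c) * real (card X)"
proof -
  let ?N = "CARD('c)"
  define \<zeta> where "\<zeta> = (\<Sum>q. 1 / real q ^ 2)"
  have "(\<lambda>K. (12 ^ ?N * \<zeta>) * real K powr - real ?N) \<longlonglongrightarrow> 0"
    by (rule tendsto_neg_powr_nat) simp
  then have "\<forall>\<^sub>F K in sequentially. (12 ^ ?N * \<zeta>) * real K powr - real ?N < \<rho> ^ ?N / 4"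
    by (rule order_tendstoD) (use assms in auto)
  then show ?thesis
    using eventually_gt_at_top[of 0]
  proof eventually_elim
    case (elim K)
    then have K: "K > 0" and tail: "12 ^ ?N * \<zeta> / real K ^ ?N < \<rho> ^ ?N / 4"
      by (simp_all add: powr_neg_nat)
    define \<kappa> where "\<kappa> = spacing ?N K"
    have \<kappa>: "\<kappa> > 0" using K by (simp add: \<kappa>_def spacing_def)
    define L where "L = real K ^ ?N / 4 ^ (?N + 1)"
    have L: "L > 0" using K by (simp add: L_def)
    have L\<kappa>: "1 / (L * real K) = \<kappa>" using K by (simp add: L_def \<kappa>_def spacing_def power_divide)
    define n where "n = nat \<lfloor>L\<rfloor>"
    have n: "real n \<le> L" using L by (simp add: n_def)
    define bad where "bad = near_small_denominator z (\<rho> / 2) K n"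
    have bad_fm: "bad \<in> fmeasurable lborel"
      unfolding bad_def by (rule measure_near_small_denominator(1)) (use assms K in auto)
    have "measure lborel bad \<le> (real n * (8 * (\<rho> / 2)) ^ ?N + 12 ^ ?N * \<zeta>) / real K ^ ?N"
      unfolding bad_def \<zeta>_def by (rule measure_near_small_denominator(2)) (use assms K in auto)
    also have "\<dots> = real n * (4 * \<rho>) ^ ?N / real K ^ ?N + 12 ^ ?N * \<zeta> / real K ^ ?N"
      by (simp add: add_divide_distrib)
    also have "\<dots> \<le> L * (4 * \<rho>) ^ ?N / real K ^ ?N + 12 ^ ?N * \<zeta> / real K ^ ?N"
      using n assms by (intro add_right_mono divide_right_mono mult_right_mono) auto
    also have "L * (4 * \<rho>) ^ ?N / real K ^ ?N = \<rho> ^ ?N / 4"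
      using K by (simp add: L_def power_mult_distrib)
    \<comment> \<open>The factor \<open>4\<^bsup>-(N+1)\<^esup>\<close> in the definition of \<open>L\<close> is chosen to get a quarter of the volume here; the tail is the other quarter.\<close>
    finally have bad: "measure lborel bad \<le> \<rho> ^ ?N / 2" using tail by linarith
    define good where "good x \<longleftrightarrow> (\<exists>q p. L \<le> real q \<and> q \<le> K ^ ?N \<and> x = rat_point p q)" for x :: "real^'c"
    define R where "R = {x \<in> cube z (\<rho> / 2 + \<kappa>). good x}"
    have finR: "finite R"
    proof (rule finite_subset)
      let ?P = "\<lambda>q. {p::int^'c. \<forall>j. \<bar>of_int (p $ j) - (\<chi> j. real q * z $ j) $ j\<bar> \<le> real q * (\<rho> / 2 + \<kappa>)}"
      show "R \<subseteq> (\<Union>q\<in>{1..K ^ ?N}. (\<lambda>p. rat_point p q) ` ?P q)"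
      proof
        fix x assume "x \<in> R"
        then obtain q p where xc: "x \<in> cube z (\<rho> / 2 + \<kappa>)" and q: "L \<le> real q" "q \<le> K ^ ?N"
          and x: "x = rat_point p q" by (auto simp: R_def good_def)
        have q0: "real q > 0" using q L by linarith
        have "p \<in> ?P q"
        proof safe
          fix j
          have "\<bar>of_int (p $ j) - real q * z $ j\<bar> = real q * \<bar>x $ j - z $ j\<bar>"
            using q0 rat_point_diff[of q p j "z $ j"] by (simp add: x abs_minus_commute)
          also have "\<dots> \<le> real q * (\<rho> / 2 + \<kappa>)"
            using xc q0 by (auto simp: cube_def)
          finally show "\<bar>of_int (p $ j) - (\<chi> j. real q * z $ j) $ j\<bar> \<le> real q * (\<rho> / 2 + \<kappa>)" by simp
        qed
        then show "x \<in> (\<Union>q\<in>{1..K ^ ?N}. (\<lambda>p. rat_point p q) ` ?P q)"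
          using x q q0 by (auto intro!: bexI[of _ q])
      qed
      have nn: "real q * (\<rho> / 2 + \<kappa>) \<ge> 0" for q using assms \<kappa> by simp
      show "finite (\<Union>q\<in>{1..K ^ ?N}. (\<lambda>p. rat_point p q) ` ?P q)"
        using card_int_vec_near(1)[OF nn] by blast
    qed
    obtain X where X: "X \<subseteq> R" "separated \<kappa> X" and max: "\<And>x. x \<in> R \<Longrightarrow> \<exists>y\<in>X. x \<in> cube y \<kappa>"
      using maximal_separated_subset[OF finR, of \<kappa>] \<kappa> by metis
    have finX: "finite X" using X finR finite_subset by blast
    have cover: "cube z (\<rho> / 2) \<subseteq> bad \<union> (\<Union>x\<in>X. cube x (2 * \<kappa>))"
    proof
      fix x assume x: "x \<in> cube z (\<rho> / 2)"
      obtain q :: nat and p :: "int^'c" where q: "0 < q" "q \<le> K ^ ?N"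
        and qp: "\<And>j. \<bar>real q * x $ j - of_int (p $ j)\<bar> < 1 / real K"
        using dirichlet_vec[OF K] by blast
      have diff: "\<bar>x $ j - rat_point p q $ j\<bar> \<le> 1 / (real q * real K)" for j
      proof -
        have "\<bar>x $ j - rat_point p q $ j\<bar> = \<bar>real q * x $ j - of_int (p $ j)\<bar> / real q"
          using q rat_point_diff[of q p j "x $ j"] by (simp add: abs_minus_commute)
        also have "\<dots> \<le> (1 / real K) / real q"
          using qp[of j] by (intro divide_right_mono) auto
        finally show ?thesis by (simp add: mult.commute)
      qed
      show "x \<in> bad \<union> (\<Union>x\<in>X. cube x (2 * \<kappa>))"
      proof (cases "L \<le> real q")
        case True
        have "1 / (real q * real K) \<le> 1 / (L * real K)"
          using True L K q by (intro divide_left_mono mult_right_mono) auto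
        then have xr: "x \<in> cube (rat_point p q) \<kappa>"
          using order.trans[OF diff] L\<kappa> unfolding cube_def by simp
        then have rx: "rat_point p q \<in> cube x \<kappa>" by (simp add: cube_def abs_minus_commute)
        have "rat_point p q \<in> cube z (\<kappa> + \<rho> / 2)" by (rule cube_trans[OF rx x])
        then have "rat_point p q \<in> R" using True q by (auto simp: R_def good_def add.commute)
        then obtain y where y: "y \<in> X" "rat_point p q \<in> cube y \<kappa>" using max by blast
        have "x \<in> cube y (\<kappa> + \<kappa>)" by (rule cube_trans[OF xr y(2)])
        then show ?thesis using y by auto
      next
        case False
        then have qn: "q \<le> n" unfolding n_def by linarith
        have "\<bar>of_int (p $ j) - real q * z $ j\<bar> \<le> real q * (\<rho> / 2) + 1" for j
        proof -
          have "\<bar>real q * x $ j - real q * z $ j\<bar> = real q * \<bar>x $ j - z $ j\<bar>"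
            by (simp add: abs_mult right_diff_distrib[symmetric])
          also have "\<dots> \<le> real q * (\<rho> / 2)" using x by (intro mult_left_mono) (auto simp: cube_def)
          finally have "\<bar>real q * x $ j - real q * z $ j\<bar> \<le> real q * (\<rho> / 2)" .
          moreover have "1 / real K \<le> 1" using K by simp
          ultimately show ?thesis using qp[of j] by linarith
        qed
        then have "x \<in> bad"
          unfolding bad_def near_small_denominator_def using q qn diff
          by (auto simp: cube_def intro!: bexI[of _ q] exI[of _ p])
        then show ?thesis by simp
      qed
    qed
    have "\<rho> ^ ?N = measure lborel (cube z (\<rho> / 2))"
      using assms by (subst measure_cube) auto
    also have "\<dots> \<le> measure lborel (bad \<union> (\<Union>x\<in>X. cube x (2 * \<kappa>)))"
      using bad_fm finX by (intro measure_mono_fmeasurable cover fmeasurable.Un fmeasurable.finite_UN) auto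
    also have "\<dots> \<le> measure lborel bad + measure lborel (\<Union>x\<in>X. cube x (2 * \<kappa>))"
      using bad_fm finX by (intro measure_Un_le fmeasurableD fmeasurable.finite_UN) auto
    also have "measure lborel (\<Union>x\<in>X. cube x (2 * \<kappa>)) \<le> (\<Sum>x\<in>X. measure lborel (cube x (2 * \<kappa>)))"
      using finX by (intro measure_UNION_le) auto
    also have "\<dots> = real (card X) * (4 * \<kappa>) ^ ?N"
      using \<kappa> by (subst measure_cube) auto
    finally have "\<rho> ^ ?N \<le> 2 * (4 * \<kappa>) ^ ?N * real (card X)" using bad by (simp add: algebra_simps)
    then show ?case
      using X finX unfolding R_def good_def \<kappa>_def L_def by (intro exI[of _ X]) blast
  qed
qed

section \<open>Nested cubes that avoid a given cover\<close>

definition hit_sum :: "(nat \<Rightarrow> 'a set) \<Rightarrow> (nat \<Rightarrow> real) \<Rightarrow> real \<Rightarrow> 'a set \<Rightarrow> real" where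
  "hit_sum U r s B = (\<Sum>i. if U i \<inter> B = {} then 0 else r i powr s)"

lemma hit_summable:
  fixes r :: "nat \<Rightarrow> real"
  assumes "summable (\<lambda>i. if U i = {} then 0 else r i powr s)"
  shows "summable (\<lambda>i. if U i \<inter> B = {} then 0 else r i powr s)"
  by (rule summable_comparison_test'[OF assms, of 0]) auto

lemma sum_le_hit_sum:
  assumes "summable (\<lambda>i. if U i = {} then 0 else r i powr s)" and "finite F"
  shows "(\<Sum>i\<in>F. if U i \<inter> B = {} then 0 else r i powr s) \<le> hit_sum U r s B"
  unfolding hit_sum_def by (intro sum_le_suminf hit_summable assms) auto

text \<open>The bound on the sum over the sets that meet \<open>B\<close> controls each of them, so no such set is
as large as \<open>B\<close> itself when \<open>B\<close> is a cube of radius \<open>\<rho>\<close>.\<close>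

lemma radius_less_if_hit:
  assumes "summable (\<lambda>i. if U i = {} then 0 else r i powr s)"
    and "hit_sum U r s B < c * \<rho> powr s" "c \<le> 1" "U i \<inter> B \<noteq> {}" "s > 0" "\<rho> > 0"
  shows "r i < \<rho>"
proof -
  have "r i powr s \<le> hit_sum U r s B"
    using sum_le_hit_sum[OF assms(1), of "{i}" B] assms(4) by simp
  also have "\<dots> < c * \<rho> powr s" by (rule assms)
  also have "\<dots> \<le> 1 * \<rho> powr s" using assms by (intro mult_right_mono) auto
  finally have "r i powr s < \<rho> powr s" by simp
  then show ?thesis
    using powr_mono2[of s \<rho> "r i"] assms by (meson less_imp_le not_le)
qed

lemma cover_const_bounds:
  fixes c :: real
  assumes "c = 1 / (4 * 48 ^ N)"
  shows "0 < c" "c \<le> 1"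
proof -
  have "(1::real) \<le> 48 ^ N" by simp
  then have "(1::real) \<le> 4 * 48 ^ N" by linarith
  then show "0 < c" "c \<le> 1" unfolding assms by (auto simp: divide_le_eq)
qed

text \<open>One step of the construction. Suppose that the sets of a cover that meet \<open>cube z \<rho>\<close> are
small in total: \<open>\<Sum> r\<^sub>i\<^sup>s < c \<rho>\<^sup>s\<close>. Consider tiny cubes of radius \<open>\<rho>'\<close> around the well-spaced fractions with
spacing \<open>\<kappa>\<close>. A set with \<open>r\<^sub>i > \<kappa> / 3\<close> meets at most \<open>(12 r\<^sub>i / \<kappa>)\<^sup>N\<close> of them, and as
\<open>r\<^sub>i\<^sup>N \<le> \<rho>\<^bsup>N-s\<^esup> r\<^sub>i\<^sup>s\<close> the constant \<open>c\<close> guarantees that these sets together spoil at most half of the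
tiny cubes. Each remaining set meets at most one tiny cube, so the average over the unspoilt ones of the sum
of \<open>r\<^sub>i\<^sup>s\<close> is at most \<open>c \<rho>\<^sup>s\<close> divided by their number. That number is of order
\<open>\<rho>\<^sup>N K\<^bsup>N(N+1)\<^esup>\<close>, whereas \<open>\<rho>'\<^sup>s\<close> is of order \<open>K\<^bsup>-N(1+\<tau>)s\<^esup>\<close>; since \<open>(1 + \<tau>) s < N + 1\<close>, some tiny
cube satisfies the hypothesis again once \<open>K\<close> is large.

The constant: \<open>48 = 12 \<cdot> 4\<close> combines the packing bound above with the covering radius
\<open>2 \<kappa>\<close> behind the number of fractions, which is at least \<open>\<rho>\<^sup>N / (2 (4 \<kappa>)\<^sup>N)\<close>.\<close>

lemma child_cube:
  fixes U :: "nat \<Rightarrow> (real^'c) set" and z :: "real^'c"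
  assumes N: "CARD('c) \<ge> 2" and \<rho>: "\<rho> > 0" and r: "\<And>i. r i > 0"
    and U: "\<forall>i. \<forall>x\<in>U i. \<forall>y\<in>U i. \<forall>j. \<bar>x $ j - y $ j\<bar> \<le> r i"
    and sm: "summable (\<lambda>i. if U i = {} then 0 else r i powr s)"
    and \<tau>: "\<tau> \<ge> 1" and s: "0 < s" "s < (real CARD('c) + 1) / (1 + \<tau>)"
    and c: "c = 1 / (4 * 48 ^ CARD('c))"
    and hit: "hit_sum U r s (cube z \<rho>) < c * \<rho> powr s"
  obtains q p \<rho>' where "b < q" "0 < \<rho>'" "\<rho>' \<le> \<rho> / 2" "real q * \<rho>' < real q powr - \<tau>"
    "cube (rat_point p q) \<rho>' \<subseteq> cube z \<rho>"
    "hit_sum U r s (cube (rat_point p q) \<rho>') < c * \<rho>' powr s"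
proof -
  let ?N = "CARD('c)"
  note c0 = cover_const_bounds[OF c]
  have sN: "s \<le> real ?N"
  proof -
    have "(real ?N + 1) / (1 + \<tau>) \<le> (real ?N + 1) / 2" using \<tau> by (intro divide_left_mono) auto
    also have "\<dots> \<le> real ?N" using N by simp
    finally show ?thesis using s by linarith
  qed
  have exps: "s * (1 + \<tau>) < real ?N + 1" using s \<tau> by (simp add: field_simps)
  \<comment> \<open>This radius is below \<open>q\<^bsup>-1-\<tau>\<^esup>\<close> for every denominator \<open>q \<le> K\<^sup>N\<close>.\<close>
  define rad where "rad K = (1/2) * real K powr - (real ?N * (1 + \<tau>))" for K :: nat
  \<comment> \<open>The requirements on \<open>K\<close>: the child fits into the parent (the first two), its denominator exceeds \<open>b\<close>, and half the number of children times \<open>\<rho>'\<^sup>s\<close> is at least \<open>\<rho>\<^sup>s\<close>.\<close>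
  have ev1: "\<forall>\<^sub>F K in sequentially. rad K < \<rho> / 4"
    unfolding rad_def by (rule order_tendstoD(2)[OF tendsto_neg_powr_nat]) (use \<rho> \<tau> in auto)
  have ev2: "\<forall>\<^sub>F K in sequentially. 4 ^ (?N + 1) * real K powr - real (?N + 1) < \<rho> / 4"
    by (rule order_tendstoD(2)[OF tendsto_neg_powr_nat]) (use \<rho> in auto)
  have ev3: "\<forall>\<^sub>F K in sequentially. (real b * 4 ^ (?N + 1)) * real K powr - real ?N < 1"
    by (rule order_tendstoD(2)[OF tendsto_neg_powr_nat]) auto
  have ev4: "\<forall>\<^sub>F K in sequentially. (4 * \<rho> powr s * (4 * 4 ^ (?N + 1)) ^ ?N * 2 powr s)
      * real K powr (real ?N * (s * (1 + \<tau>) - (real ?N + 1))) < \<rho> ^ ?N"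
    by (rule order_tendstoD(2)[OF tendsto_neg_powr_nat]) (use \<rho> exps in \<open>auto simp: mult_less_0_iff\<close>)
  obtain K X where K: "K > 0" and finX: "finite X" and Xsub: "X \<subseteq> cube z (\<rho> / 2 + spacing ?N K)"
    and sep: "separated (spacing ?N K) X"
    and Xrat: "\<And>x. x \<in> X \<Longrightarrow> \<exists>q p. real K ^ ?N / 4 ^ (?N + 1) \<le> real q \<and> q \<le> K ^ ?N \<and> x = rat_point p q"
    and Xcard: "\<rho> ^ ?N \<le> 2 * (4 * spacing ?N K) ^ ?N * real (card X)"
    and K1: "rad K < \<rho> / 4" and K2: "4 ^ (?N + 1) * real K powr - real (?N + 1) < \<rho> / 4"
    and K3: "(real b * 4 ^ (?N + 1)) * real K powr - real ?N < 1"
    and K4: "(4 * \<rho> powr s * (4 * 4 ^ (?N + 1)) ^ ?N * 2 powr s)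
      * real K powr (real ?N * (s * (1 + \<tau>) - (real ?N + 1))) < \<rho> ^ ?N"
  proof -
    from eventually_conj[OF well_spaced_rationals[OF N \<rho>, of z] eventually_conj[OF eventually_gt_at_top[of 0]
        eventually_conj[OF ev1 eventually_conj[OF ev2 eventually_conj[OF ev3 ev4]]]]]
    have "\<exists>K. (\<exists>X. finite X \<and> X \<subseteq> cube z (\<rho> / 2 + spacing CARD('c) K)
      \<and> separated (spacing CARD('c) K) X
      \<and> (\<forall>x\<in>X. \<exists>q p. real K ^ CARD('c) / 4 ^ (CARD('c) + 1) \<le> real q \<and> q \<le> K ^ CARD('c) \<and> x = rat_point p q)
      \<and> \<rho> ^ CARD('c) \<le> 2 * (4 * spacing CARD('c) K) ^ CARD('c) * real (card X)) \<and> 0 < K \<and> rad K < \<rho> / 4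
      \<and> 4 ^ (?N + 1) * real K powr - real (?N + 1) < \<rho> / 4
      \<and> (real b * 4 ^ (?N + 1)) * real K powr - real ?N < 1
      \<and> (4 * \<rho> powr s * (4 * 4 ^ (?N + 1)) ^ ?N * 2 powr s)
      * real K powr (real ?N * (s * (1 + \<tau>) - (real ?N + 1))) < \<rho> ^ ?N"
      by (rule eventually_happens'[OF sequentially_bot])
    then show thesis using that by blast
  qed
  define \<kappa> where "\<kappa> = spacing ?N K"
  define \<rho>' where "\<rho>' = rad K"
  have \<kappa>: "\<kappa> > 0" using K by (simp add: \<kappa>_def spacing_def)
  have \<kappa>_eq: "\<kappa> = 4 ^ (?N + 1) * real K powr - real (?N + 1)" using K by (simp add: \<kappa>_def spacing_powr)
  have \<rho>'0: "\<rho>' > 0" using K by (simp add: \<rho>'_def rad_def)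
  have room: "\<rho>' + (\<rho> / 2 + \<kappa>) \<le> \<rho>" "\<rho>' \<le> \<rho> / 2"
    using K1 K2 \<kappa>_eq \<rho> unfolding \<rho>'_def by linarith+
  have small: "3 * \<rho>' < \<kappa>"
  proof -
    have "real K powr - (real ?N * (1 + \<tau>)) \<le> real K powr - real (?N + 1)"
    proof (rule powr_mono)
      have "real ?N * 1 \<le> real ?N * \<tau>" using \<tau> by (intro mult_left_mono) auto
      moreover have "2 \<le> real ?N" using N by simp
      ultimately show "- (real ?N * (1 + \<tau>)) \<le> - real (?N + 1)"
        unfolding distrib_left of_nat_add of_nat_1 by linarith
    qed (use K in auto)
    moreover have "(4::real) ^ (?N + 1) \<ge> 4"
      using power_increasing[of 1 "?N + 1" "4::real"] by simp
    then have "4 * real K powr - real (?N + 1) \<le> \<kappa>"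
      unfolding \<kappa>_eq by (rule mult_right_mono) auto
    moreover have "real K powr - real (?N + 1) > 0" using K by simp
    ultimately show ?thesis unfolding \<rho>'_def rad_def by linarith
  qed
  have gain: "4 * (4 * \<kappa>) ^ ?N * \<rho> powr s \<le> \<rho> ^ ?N * \<rho>' powr s"
  proof -
    define E where "E = real ?N * (1 + \<tau>) * s"
    have rs: "\<rho>' powr s = 2 powr - s * real K powr - E"
      unfolding \<rho>'_def rad_def E_def
      by (simp add: powr_mult powr_powr powr_minus powr_divide inverse_eq_divide mult.assoc)
    have kN: "(4 * \<kappa>) ^ ?N = (4 * 4 ^ (?N + 1)) ^ ?N * real K powr - (real ?N * (real ?N + 1))"
    proof -
      have "(real K powr - real (?N + 1)) ^ ?N = real K powr (- real (?N + 1) * real ?N)"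
        using K by (subst powr_realpow[symmetric]) (auto simp: powr_powr)
      also have "- real (?N + 1) * real ?N = - (real ?N * (real ?N + 1))" by (simp add: algebra_simps)
      finally show ?thesis unfolding \<kappa>_eq by (simp add: power_mult_distrib)
    qed
    have "real K powr (real ?N * (s * (1 + \<tau>) - (real ?N + 1)))
        = real K powr - (real ?N * (real ?N + 1)) * real K powr E"
      unfolding powr_add[symmetric] E_def by (simp add: algebra_simps)
    then have "(4 * (4 * \<kappa>) ^ ?N * \<rho> powr s) * (2 powr s * real K powr E) < \<rho> ^ ?N"
      using K4 unfolding kN by (simp add: mult_ac)
    then have "(4 * (4 * \<kappa>) ^ ?N * \<rho> powr s) * (2 powr s * real K powr E) * \<rho>' powr s \<le> \<rho> ^ ?N * \<rho>' powr s"
      by (intro mult_right_mono) auto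
    moreover have "(2 powr s * real K powr E) * \<rho>' powr s = 1"
      unfolding rs using K by (simp add: powr_minus field_simps)
    ultimately show ?thesis by (simp add: mult.assoc)
  qed
  have child_sub: "cube x \<rho>' \<subseteq> cube z \<rho>" if "x \<in> X" for x
  proof
    fix y assume "y \<in> cube x \<rho>'"
    moreover have "x \<in> cube z (\<rho> / 2 + \<kappa>)" using that Xsub by (auto simp: \<kappa>_def)
    ultimately have "y \<in> cube z (\<rho>' + (\<rho> / 2 + \<kappa>))" by (rule cube_trans)
    then show "y \<in> cube z \<rho>" using cube_mono[OF room(1)] by blast
  qed
  let ?h = "\<lambda>B i. if U i \<inter> B = {} then 0 else r i powr s"
  note h_le = sum_le_hit_sum[OF sm]
  have r_lt: "r i < \<rho>" if "U i \<inter> cube z \<rho> \<noteq> {}" for i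
    using radius_less_if_hit[OF sm hit] c0 that s \<rho> by blast
  define big where "big = {i. \<kappa> / 3 < r i \<and> U i \<inter> cube z \<rho> \<noteq> {}}"
  have fin_big: "finite big"
  proof -
    have "\<forall>\<^sub>F i in sequentially. ?h (cube z \<rho>) i < (\<kappa> / 3) powr s"
      by (rule order_tendstoD(2)[OF summable_LIMSEQ_zero[OF hit_summable[OF sm]]]) (use \<kappa> in auto)
    then obtain i0 where i0: "\<And>i. i \<ge> i0 \<Longrightarrow> ?h (cube z \<rho>) i < (\<kappa> / 3) powr s"
      by (auto simp: eventually_sequentially)
    have small_radius: "r i \<le> \<kappa> / 3" if "i \<ge> i0" "U i \<inter> cube z \<rho> \<noteq> {}" for i
    proof (rule ccontr)
      assume "\<not> r i \<le> \<kappa> / 3"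
      then have "(\<kappa> / 3) powr s \<le> r i powr s" using s \<kappa> by (intro powr_mono2) auto
      with i0[OF that(1)] that(2) show False by simp
    qed
    have "big \<subseteq> {..<i0}"
    proof
      fix i assume "i \<in> big"
      then show "i \<in> {..<i0}" using small_radius[of i] by (cases "i0 \<le> i") (auto simp: big_def)
    qed
    then show ?thesis using finite_subset by blast
  qed
  define X' where "X' = {x\<in>X. \<forall>i. \<kappa> / 3 < r i \<longrightarrow> U i \<inter> cube x \<rho>' = {}}"
  have finX': "finite X'" using finX by (simp add: X'_def)
  \<comment> \<open>All children met by \<open>U i\<close> have their centres in one cube of radius \<open>3 r i\<close>.\<close>
  have few_hit: "real (card {x\<in>X. U i \<inter> cube x \<rho>' \<noteq> {}}) \<le> (12 * r i / \<kappa>) ^ ?N" if i: "i \<in> big" for i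
  proof (cases "{x\<in>X. U i \<inter> cube x \<rho>' \<noteq> {}} = {}")
    case True
    show ?thesis using r[of i] \<kappa> unfolding True by simp
  next
    case False
    then obtain x0 u0 where x0: "x0 \<in> X" "u0 \<in> U i" "u0 \<in> cube x0 \<rho>'" by auto
    have ri: "\<kappa> < 3 * r i" using i by (simp add: big_def)
    have sub: "{x\<in>X. U i \<inter> cube x \<rho>' \<noteq> {}} \<subseteq> cube x0 (3 * r i)"
    proof
      fix x assume "x \<in> {x\<in>X. U i \<inter> cube x \<rho>' \<noteq> {}}"
      then obtain u where x: "x \<in> X" "u \<in> U i" "u \<in> cube x \<rho>'" by auto
      show "x \<in> cube x0 (3 * r i)"
        unfolding cube_def
      proof safe
        fix j
        have "\<bar>u $ j - u0 $ j\<bar> \<le> r i" using U x(2) x0(2) by blast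
        moreover have "\<bar>u $ j - x $ j\<bar> \<le> \<rho>'" "\<bar>u0 $ j - x0 $ j\<bar> \<le> \<rho>'" using x x0 by (auto simp: cube_def)
        ultimately show "\<bar>x $ j - x0 $ j\<bar> \<le> 3 * r i" using small ri by linarith
      qed
    qed
    have "separated \<kappa> {x\<in>X. U i \<inter> cube x \<rho>' \<noteq> {}}"
      using sep by (auto simp: separated_def \<kappa>_def)
    then have "real (card {x\<in>X. U i \<inter> cube x \<rho>' \<noteq> {}}) \<le> (2 * (3 * r i) / \<kappa> + 2) ^ ?N"
      using card_separated_in_cube(2)[OF \<kappa> _ _ sub] r[of i] by simp
    also have "\<dots> \<le> (12 * r i / \<kappa>) ^ ?N"
      using ri \<kappa> r[of i] by (intro power_mono) (auto simp: field_simps)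
    finally show ?thesis .
  qed
  have "X - X' \<subseteq> (\<Union>i\<in>big. {x\<in>X. U i \<inter> cube x \<rho>' \<noteq> {}})"
  proof
    fix x assume x: "x \<in> X - X'"
    then obtain i where i: "\<kappa> / 3 < r i" "U i \<inter> cube x \<rho>' \<noteq> {}" by (auto simp: X'_def)
    then have "i \<in> big" using child_sub[of x] x by (auto simp: big_def)
    then show "x \<in> (\<Union>i\<in>big. {x\<in>X. U i \<inter> cube x \<rho>' \<noteq> {}})" using i x by auto
  qed
  then have "card (X - X') \<le> card (\<Union>i\<in>big. {x\<in>X. U i \<inter> cube x \<rho>' \<noteq> {}})"
    using fin_big finX by (intro card_mono) auto
  also have "\<dots> \<le> (\<Sum>i\<in>big. card {x\<in>X. U i \<inter> cube x \<rho>' \<noteq> {}})" by (rule card_UN_le[OF fin_big])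
  finally have "real (card (X - X')) \<le> (\<Sum>i\<in>big. real (card {x\<in>X. U i \<inter> cube x \<rho>' \<noteq> {}}))"
    unfolding of_nat_sum[symmetric] of_nat_le_iff .
  also have "\<dots> \<le> (\<Sum>i\<in>big. (12 / \<kappa>) ^ ?N * \<rho> powr (real ?N - s) * ?h (cube z \<rho>) i)"
  proof (rule sum_mono)
    fix i assume i: "i \<in> big"
    have "r i ^ ?N = r i powr (real ?N - s) * r i powr s"
      using r[of i] by (simp add: powr_realpow[symmetric] powr_add[symmetric])
    also have "\<dots> \<le> \<rho> powr (real ?N - s) * r i powr s"
      using r[of i] r_lt[of i] i sN by (intro mult_right_mono powr_mono2) (auto simp: big_def)
    finally have le: "r i ^ ?N \<le> \<rho> powr (real ?N - s) * r i powr s" .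
    have "real (card {x\<in>X. U i \<inter> cube x \<rho>' \<noteq> {}}) \<le> (12 / \<kappa>) ^ ?N * r i ^ ?N"
      using few_hit[OF i] by (simp add: power_mult_distrib[symmetric])
    also have "\<dots> \<le> (12 / \<kappa>) ^ ?N * (\<rho> powr (real ?N - s) * r i powr s)"
      using \<kappa> by (intro mult_left_mono le) auto
    finally show "real (card {x\<in>X. U i \<inter> cube x \<rho>' \<noteq> {}})
        \<le> (12 / \<kappa>) ^ ?N * \<rho> powr (real ?N - s) * ?h (cube z \<rho>) i"
      using i by (simp add: big_def mult.assoc)
  qed
  also have "\<dots> = (12 / \<kappa>) ^ ?N * \<rho> powr (real ?N - s) * sum (?h (cube z \<rho>)) big"
    by (simp add: sum_distrib_left)
  also have "\<dots> \<le> (12 / \<kappa>) ^ ?N * \<rho> powr (real ?N - s) * (c * \<rho> powr s)"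
    using h_le[OF fin_big, of "cube z \<rho>"] hit \<kappa> by (intro mult_left_mono) auto
  also have "\<dots> = (12 / \<kappa>) ^ ?N * c * \<rho> ^ ?N"
    using \<rho> by (simp add: powr_realpow[symmetric] powr_add[symmetric])
  also have "\<dots> = \<rho> ^ ?N / (4 * (4 * \<kappa>) ^ ?N)"
  proof -
    have "(48::real) ^ ?N = 4 ^ ?N * 12 ^ ?N" by (simp add: power_mult_distrib[symmetric])
    then show ?thesis unfolding c by (simp add: power_divide power_mult_distrib)
  qed
  also have "\<dots> \<le> real (card X) / 2"
    using Xcard \<kappa> by (simp add: \<kappa>_def[symmetric] field_simps)
  finally have "real (card (X - X')) \<le> real (card X) / 2" .
  moreover have "card (X - X') = card X - card X'" "card X' \<le> card X"
    using finX by (auto simp: X'_def card_Diff_subset intro!: card_mono)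
  ultimately have half: "real (card X) / 2 \<le> real (card X')" by (simp add: of_nat_diff)
  \<comment> \<open>Every set of the cover is charged to at most one child in \<open>X'\<close>.\<close>
  have total: "(\<Sum>x\<in>X'. hit_sum U r s (cube x \<rho>')) \<le> hit_sum U r s (cube z \<rho>)"
  proof -
    have "(\<Sum>x\<in>X'. hit_sum U r s (cube x \<rho>')) = (\<Sum>i. \<Sum>x\<in>X'. ?h (cube x \<rho>') i)"
      unfolding hit_sum_def by (rule suminf_sum[symmetric]) (rule hit_summable[OF sm])
    also have "\<dots> \<le> hit_sum U r s (cube z \<rho>)"
      unfolding hit_sum_def
    proof (rule suminf_le)
      show "summable (\<lambda>i. \<Sum>x\<in>X'. ?h (cube x \<rho>') i)" by (rule summable_sum) (rule hit_summable[OF sm])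
      show "summable (?h (cube z \<rho>))" by (rule hit_summable[OF sm])
      fix i
      let ?Y = "{x\<in>X'. U i \<inter> cube x \<rho>' \<noteq> {}}"
      have "(\<Sum>x\<in>X'. ?h (cube x \<rho>') i) = (\<Sum>x\<in>?Y. r i powr s)"
        using finX' by (intro sum.mono_neutral_cong_right) auto
      also have "\<dots> = real (card ?Y) * r i powr s" by simp
      also have "\<dots> \<le> ?h (cube z \<rho>) i"
      proof (cases "?Y = {}")
        case True
        show ?thesis unfolding True by simp
      next
        case False
        then have meet: "U i \<inter> cube z \<rho> \<noteq> {}" using child_sub by (force simp: X'_def)
        have "x = y" if xy: "x \<in> ?Y" "y \<in> ?Y" for x y
        proof (rule ccontr)
          assume "x \<noteq> y"
          moreover have "x \<in> X" "y \<in> X" using xy by (auto simp: X'_def)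
          ultimately obtain j where j: "\<kappa> \<le> \<bar>x $ j - y $ j\<bar>"
            using sep unfolding separated_def \<kappa>_def by blast
          obtain u v where uv: "u \<in> U i" "u \<in> cube x \<rho>'" "v \<in> U i" "v \<in> cube y \<rho>'" using xy by auto
          have "\<bar>u $ j - v $ j\<bar> \<le> r i" using U uv by blast
          moreover have "\<bar>u $ j - x $ j\<bar> \<le> \<rho>'" "\<bar>v $ j - y $ j\<bar> \<le> \<rho>'" using uv by (auto simp: cube_def)
          moreover have "r i \<le> \<kappa> / 3" using xy by (force simp: X'_def not_less[symmetric])
          ultimately show False using j small by linarith
        qed
        then have "card ?Y \<le> Suc 0" using finX' by (subst card_le_Suc0_iff_eq) auto
        then have "real (card ?Y) * r i powr s \<le> 1 * r i powr s" by (intro mult_right_mono) auto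
        then show ?thesis using meet by simp
      qed
      finally show "(\<Sum>x\<in>X'. ?h (cube x \<rho>') i) \<le> ?h (cube z \<rho>) i" .
    qed
    finally show ?thesis .
  qed
  have "\<exists>x\<in>X'. hit_sum U r s (cube x \<rho>') < c * \<rho>' powr s"
  proof (rule ccontr)
    assume "\<not> ?thesis"
    then have "real (card X') * (c * \<rho>' powr s) \<le> (\<Sum>x\<in>X'. hit_sum U r s (cube x \<rho>'))"
      by (intro sum_bounded_below) auto
    also have "\<dots> < c * \<rho> powr s" using total hit by linarith
    finally have "real (card X') * \<rho>' powr s < \<rho> powr s" using c0 by simp
    moreover have "real (card X) / 2 * \<rho>' powr s \<le> real (card X') * \<rho>' powr s"
      using half by (intro mult_right_mono) auto
    ultimately have lt: "real (card X) * \<rho>' powr s < 2 * \<rho> powr s" by linarith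
    have "4 * (4 * \<kappa>) ^ ?N * \<rho> powr s \<le> 2 * (4 * \<kappa>) ^ ?N * real (card X) * \<rho>' powr s"
      by (rule order.trans[OF gain]) (intro mult_right_mono Xcard[folded \<kappa>_def], simp)
    also have "\<dots> = (2 * (4 * \<kappa>) ^ ?N) * (real (card X) * \<rho>' powr s)" by simp
    also have "\<dots> < (2 * (4 * \<kappa>) ^ ?N) * (2 * \<rho> powr s)" using lt \<kappa> by (intro mult_strict_left_mono) auto
    finally show False by simp
  qed
  then obtain x where x: "x \<in> X'" "hit_sum U r s (cube x \<rho>') < c * \<rho>' powr s" by blast
  then obtain q p where q: "real K ^ ?N / 4 ^ (?N + 1) \<le> real q" "q \<le> K ^ ?N" "x = rat_point p q"
    using Xrat[of x] by (auto simp: X'_def)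
  have "real b < real K ^ ?N / 4 ^ (?N + 1)"
    using K3 K by (simp add: powr_neg_nat field_simps)
  then have q0: "b < q" using q by linarith
  have "real q * \<rho>' < real q powr - \<tau>"
  proof -
    have "real K powr real ?N = real K ^ ?N" using K by (simp add: powr_realpow)
    then have "real q \<le> real K powr real ?N" using q(2) by (simp flip: of_nat_power)
    then have "(real K powr real ?N) powr - (1 + \<tau>) \<le> real q powr - (1 + \<tau>)"
      using q0 \<tau> by (intro powr_mono2') auto
    then have "2 * \<rho>' \<le> real q powr - (1 + \<tau>)"
      unfolding \<rho>'_def rad_def by (simp add: powr_powr algebra_simps)
    then have "\<rho>' < real q powr - (1 + \<tau>)" using \<rho>'0 by linarith
    then have "real q * \<rho>' < real q * real q powr - (1 + \<tau>)" using q0 by simp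
    also have "\<dots> = real q powr 1 * real q powr - (1 + \<tau>)" using q0 by simp
    also have "\<dots> = real q powr - \<tau>" unfolding powr_add[symmetric] by simp
    finally show ?thesis .
  qed
  then show thesis
    using that[of q \<rho>' p] q0 \<rho>'0 room child_sub[of x] x q(3) by (auto simp: X'_def)
qed

text \<open>Iterating the step gives nested cubes whose centres are fractions with increasing denominators and
whose common point \<open>x\<close> is therefore approximable infinitely often. If \<open>x\<close> belonged to a set of the cover,
this set would meet all the cubes, and its positive size \<open>r i\<close> would be below all their radii. In other
words, the approximable points have Hausdorff content at least \<open>c / 2\<^sup>s\<close>.\<close>

lemma approximable_point_outside_cover:
  fixes U :: "nat \<Rightarrow> (real^'c) set"
  assumes N: "CARD('c) \<ge> 2" and r: "\<And>i. r i > 0"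
    and U: "\<forall>i. \<forall>x\<in>U i. \<forall>y\<in>U i. \<forall>j. \<bar>x $ j - y $ j\<bar> \<le> r i"
    and sm: "summable (\<lambda>i. if U i = {} then 0 else r i powr s)"
    and \<tau>: "\<tau> \<ge> 1" and s: "0 < s" "s < (real CARD('c) + 1) / (1 + \<tau>)"
    and c: "c = 1 / (4 * 48 ^ CARD('c))"
    and total: "(\<Sum>i. if U i = {} then 0 else r i powr s) < c * (1 / 2) powr s"
  obtains x where "x \<in> cube (\<chi> j. 1 / 2) (1 / 2)" "\<forall>i. x \<notin> U i"
    "infinite {k::nat. \<forall>j. dist_nearest_int (real k * x $ j) < real k powr - \<tau>}"
proof -
  let ?z0 = "(\<chi> j. 1 / 2) :: real^'c"
  note c1 = cover_const_bounds(2)[OF c]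
  define P where "P = (\<lambda>n::nat. \<lambda>(z::real^'c, \<rho>::real, q::nat). \<rho> > 0 \<and> hit_sum U r s (cube z \<rho>) < c * \<rho> powr s
     \<and> (n = 0 \<longrightarrow> z = ?z0 \<and> \<rho> = 1 / 2))"
  define Q where "Q = (\<lambda>n::nat. \<lambda>(z::real^'c, \<rho>::real, q::nat) (z'::real^'c, \<rho>'::real, q'::nat). q < q' \<and> \<rho>' \<le> \<rho> / 2
     \<and> cube z' \<rho>' \<subseteq> cube z \<rho> \<and> real q' * \<rho>' < real q' powr - \<tau> \<and> (\<exists>p. z' = rat_point p q'))"
  have "\<exists>f. \<forall>n. P n (f n) \<and> Q n (f n) (f (Suc n))"
  proof (rule dependent_nat_choice)
    have "hit_sum U r s (cube ?z0 (1/2)) \<le> (\<Sum>i. if U i = {} then 0 else r i powr s)"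
      unfolding hit_sum_def by (intro suminf_le hit_summable sm) auto
    then have "P 0 (?z0, 1/2, 0)" using total by (simp add: P_def)
    then show "\<exists>x. P 0 x" by blast
    fix x :: "(real^'c) \<times> real \<times> nat" and n
    assume "P n x"
    then obtain z \<rho> q where x: "x = (z, \<rho>, q)" and \<rho>: "\<rho> > 0"
      and hit: "hit_sum U r s (cube z \<rho>) < c * \<rho> powr s" by (cases x) (auto simp: P_def)
    obtain q' p \<rho>' where "q < q'" "0 < \<rho>'" "\<rho>' \<le> \<rho> / 2" "real q' * \<rho>' < real q' powr - \<tau>"
      "cube (rat_point p q') \<rho>' \<subseteq> cube z \<rho>"
      "hit_sum U r s (cube (rat_point p q') \<rho>') < c * \<rho>' powr s"
      by (rule child_cube[OF N \<rho> r U sm \<tau> s c hit, where b = q])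
    then have "P (Suc n) (rat_point p q', \<rho>', q') \<and> Q n x (rat_point p q', \<rho>', q')"
      unfolding x P_def Q_def by auto
    then show "\<exists>y. P (Suc n) y \<and> Q n x y" by blast
  qed
  then obtain f where f: "\<And>n. P n (f n)" "\<And>n. Q n (f n) (f (Suc n))" by blast
  define z \<rho> q where "z n = fst (f n)" and "\<rho> n = fst (snd (f n))" and "q n = snd (snd (f n))" for n
  have \<rho>0: "\<rho> n > 0" and hit: "hit_sum U r s (cube (z n) (\<rho> n)) < c * \<rho> n powr s"
    and q: "q n < q (Suc n)" and half: "\<rho> (Suc n) \<le> \<rho> n / 2"
    and nest: "cube (z (Suc n)) (\<rho> (Suc n)) \<subseteq> cube (z n) (\<rho> n)"
    and close: "real (q (Suc n)) * \<rho> (Suc n) < real (q (Suc n)) powr - \<tau>"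
    and rat: "\<exists>p. z (Suc n) = rat_point p (q (Suc n))" for n
    using f(1)[of n] f(2)[of n] by (auto simp: P_def Q_def z_def \<rho>_def q_def split: prod.splits)
  have z0: "z 0 = ?z0" "\<rho> 0 = 1/2" using f(1)[of 0] by (auto simp: P_def z_def \<rho>_def split: prod.splits)
  have "(\<Inter>n. cube (z n) (\<rho> n)) \<noteq> {}"
  proof (rule compact_nest)
    show "compact (cube (z n) (\<rho> n))" for n by (simp add: cube_eq_cbox)
    show "cube (z n) (\<rho> n) \<noteq> {}" for n
      using \<rho>0[of n] less_imp_le by (auto simp: cube_def intro!: exI[of _ "z n"])
    show "cube (z n) (\<rho> n) \<subseteq> cube (z m) (\<rho> m)" if "m \<le> n" for m n
      using lift_Suc_antimono_le[of "\<lambda>n. cube (z n) (\<rho> n)", OF nest that] .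
  qed
  then obtain x where x: "\<And>n. x \<in> cube (z n) (\<rho> n)" by auto
  have \<rho>_le: "\<rho> n \<le> (1 / 2) ^ Suc n" for n
  proof (induction n)
    case (Suc n)
    then show ?case using half[of n] by simp
  qed (simp add: z0)
  show thesis
  proof (rule that)
    show "x \<in> cube ?z0 (1 / 2)" using x[of 0] z0 by simp
    show "\<forall>i. x \<notin> U i"
    proof (intro allI notI)
      fix i assume "x \<in> U i"
      then have "U i \<inter> cube (z n) (\<rho> n) \<noteq> {}" for n using x by blast
      then have lt: "r i < \<rho> n" for n
        using radius_less_if_hit[OF sm hit c1] s \<rho>0 by blast
      obtain n where "(1 / 2) ^ n < r i" using real_arch_pow_inv[of "r i" "1/2"] r by auto
      moreover have "(1 / 2 :: real) ^ Suc n \<le> (1 / 2) ^ n" by simp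
      ultimately show False using lt[of n] \<rho>_le[of n] by linarith
    qed
    have "dist_nearest_int (real (q (Suc n)) * x $ j) < real (q (Suc n)) powr - \<tau>" for n j
    proof -
      obtain p where p: "z (Suc n) = rat_point p (q (Suc n))" using rat by blast
      have q0: "q (Suc n) > 0" using q[of n] by linarith
      have "dist_nearest_int (real (q (Suc n)) * x $ j) \<le> \<bar>real (q (Suc n)) * x $ j - of_int (p $ j)\<bar>"
        unfolding dist_nearest_int_def by (rule round_diff_minimal)
      also have "\<dots> = real (q (Suc n)) * \<bar>x $ j - z (Suc n) $ j\<bar>"
        using rat_point_diff[OF q0, of p j "x $ j"] q0 by (simp add: p abs_minus_commute)
      also have "\<dots> \<le> real (q (Suc n)) * \<rho> (Suc n)"
        using x[of "Suc n"] by (intro mult_left_mono) (auto simp: cube_def)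
      also have "\<dots> < real (q (Suc n)) powr - \<tau>" by (rule close)
      finally show ?thesis .
    qed
    then have "range (\<lambda>n. q (Suc n)) \<subseteq> {k. \<forall>j. dist_nearest_int (real k * x $ j) < real k powr - \<tau>}"
      by auto
    moreover have "strict_mono (\<lambda>n. q (Suc n))" using q by (simp add: strict_mono_Suc_iff)
    then have "infinite (range (\<lambda>n. q (Suc n)))" by (intro range_inj_infinite strict_mono_imp_inj_on)
    ultimately show "infinite {k. \<forall>j. dist_nearest_int (real k * x $ j) < real k powr - \<tau>}"
      using infinite_super by blast
  qed
qed

section \<open>Matrices with one approximable row\<close>

definition with_row :: "'r \<Rightarrow> real^'c^'r \<Rightarrow> real^'c \<Rightarrow> real^'c^'r" where
  "with_row i0 Y x = (\<chi> i. if i = i0 then x else Y $ i)"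

lemma max_abs_axis: "max_abs (axis i0 (int k) :: int^'r) = real k"
proof -
  have "range (\<lambda>j. real_of_int \<bar>(axis i0 (int k) :: int^'r) $ j\<bar>) \<subseteq> {0, real k}"
    by (auto simp: axis_def)
  moreover have "real k \<in> range (\<lambda>j. real_of_int \<bar>(axis i0 (int k) :: int^'r) $ j\<bar>)"
    by (rule image_eqI[of _ _ i0]) (auto simp: axis_def)
  ultimately show ?thesis unfolding max_abs_def by (intro Max_eqI) auto
qed

lemma height_axis:
  assumes "k \<ge> 1"
  shows "height (axis i0 (int k) :: int^'r) = real k"
proof -
  have "height (axis i0 (int k) :: int^'r) = (\<Prod>j\<in>UNIV. if j = i0 then real k else 1)"
    unfolding height_def using assms by (intro prod.cong) (auto simp: axis_def)
  then show ?thesis by simp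
qed

text \<open>Integer vectors supported on the coordinate \<open>i0\<close> see only the row \<open>i0\<close> of the matrix. For them
height and maximum norm agree, so \<open>\<sigma>\<^sub>2 = 1\<close> and the condition is simultaneous approximation of that row
with exponent \<open>\<gamma> (1 + d)\<close>, whatever the other rows are.\<close>

lemma with_row_approximable:
  fixes x :: "real^'c" and Y :: "real^'c^'r"
  assumes x: "x \<in> cube (\<chi> j. 1 / 2) (1 / 2)" and Y: "\<And>i j. Y $ i $ j \<in> {0..1}"
    and inf: "infinite {k::nat. \<forall>j. dist_nearest_int (real k * x $ j) < real k powr - (\<gamma> * (1 + real d))}"
  shows "with_row i0 Y x \<in> approximable_matrices d \<gamma>"
  unfolding approximable_matrices_def
proof (intro CollectI conjI allI)
  fix i j
  have "\<bar>x $ j - 1/2\<bar> \<le> 1/2" using x by (auto simp: cube_def)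
  then have "x $ j \<in> {0..1}" unfolding atLeastAtMost_iff by linarith
  then show "with_row i0 Y x $ i $ j \<in> {0..1}" using Y by (simp add: with_row_def)
next
  let ?S = "{k::nat. \<forall>j. dist_nearest_int (real k * x $ j) < real k powr - (\<gamma> * (1 + real d))}"
  let ?q = "\<lambda>k::nat. axis i0 (int k) :: int^'r"
  have "infinite (?S - {0})" using inf by simp
  moreover have "inj_on ?q (?S - {0})" by (rule inj_onI) (simp add: axis_eq_axis)
  ultimately have infq: "infinite (?q ` (?S - {0}))" using finite_imageD by blast
  show "infinite {q. \<exists>\<sigma>\<^sub>1 \<sigma>\<^sub>2. max_abs q = height q powr \<sigma>\<^sub>2 \<and> \<sigma>\<^sub>1 = \<gamma> * (1 + real d * \<sigma>\<^sub>2) \<and>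
      Max (range (\<lambda>j. dist_nearest_int ((\<chi> i. real_of_int (q $ i)) \<bullet> column j (with_row i0 Y x))))
        < height q powr - \<sigma>\<^sub>1}" (is "infinite ?Q")
  proof (rule infinite_super[OF _ infq])
    show "?q ` (?S - {0}) \<subseteq> ?Q"
    proof
      fix q assume "q \<in> ?q ` (?S - {0})"
      then obtain k where "k \<in> ?S - {0}" and q: "q = ?q k" by blast
      then have k: "k \<in> ?S" "k \<ge> 1" by auto
      have "(\<chi> i. real_of_int (q $ i)) \<bullet> column j (with_row i0 Y x) = real k * x $ j" for j
      proof -
        have "(\<chi> i. real_of_int (q $ i)) \<bullet> column j (with_row i0 Y x)
            = (\<Sum>i\<in>UNIV. if i = i0 then real k * x $ j else 0)"
          unfolding inner_vec_def q by (intro sum.cong) (auto simp: axis_def column_def with_row_def)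
        then show ?thesis by simp
      qed
      then have "Max (range (\<lambda>j. dist_nearest_int ((\<chi> i. real_of_int (q $ i)) \<bullet> column j (with_row i0 Y x))))
          < height q powr - (\<gamma> * (1 + real d * 1))"
        using k by (simp add: q height_axis)
      moreover have "max_abs q = height q powr 1" using k by (simp add: q height_axis max_abs_axis)
      ultimately show "q \<in> ?Q" by blast
    qed
  qed
qed

lemma prod_Basis_rows:
  fixes g :: "'r::finite \<Rightarrow> real"
  shows "(\<Prod>b\<in>(Basis :: (real^'c^'r) set). (\<chi> i. \<chi> j. g i) \<bullet> b) = (\<Prod>i\<in>UNIV. g i ^ CARD('c))"
proof -
  let ?f = "\<lambda>(i, u::real^'c). axis i u :: real^'c^'r"
  have B: "(Basis :: (real^'c^'r) set) = ?f ` (UNIV \<times> Basis)"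
    by (auto simp: Basis_vec_def)
  have inj: "inj_on ?f (UNIV \<times> Basis)"
    by (auto simp: inj_on_def axis_eq_axis)
  have g: "((\<chi> j. g i) :: real^'c) \<bullet> u = g i" if "u \<in> Basis" for i and u :: "real^'c"
    using that by (auto simp: Basis_vec_def inner_axis)
  have "(\<Prod>b\<in>(Basis :: (real^'c^'r) set). (\<chi> i. \<chi> j. g i) \<bullet> b)
      = (\<Prod>(i, u)\<in>UNIV \<times> (Basis :: (real^'c) set). g i)"
    unfolding B by (subst prod.reindex[OF inj]) (auto intro!: prod.cong simp: inner_axis g)
  also have "\<dots> = (\<Prod>i\<in>UNIV. \<Prod>u\<in>(Basis :: (real^'c) set). g i)"
    by (rule prod.cartesian_product[symmetric])
  also have "\<dots> = (\<Prod>i\<in>UNIV. g i ^ CARD('c))" by simp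
  finally show ?thesis .
qed

lemma emeasure_matrix_box:
  fixes a :: "real^'c^'r" and g :: "'r \<Rightarrow> real"
  assumes "\<And>i. g i \<ge> 0"
  shows "emeasure lborel {Y. \<forall>i j. a $ i $ j \<le> Y $ i $ j \<and> Y $ i $ j \<le> a $ i $ j + g i}
    = ennreal (\<Prod>i\<in>UNIV. g i ^ CARD('c))"
    and "{Y. \<forall>i j. a $ i $ j \<le> Y $ i $ j \<and> Y $ i $ j \<le> a $ i $ j + g i} \<in> sets borel"
proof -
  let ?b = "a + (\<chi> i. \<chi> j. g i)"
  have B: "(\<forall>b\<in>Basis. P b) = (\<forall>i j. P (axis i (axis j 1)))" for P :: "real^'c^'r \<Rightarrow> bool"
    by (auto simp: Basis_vec_def)
  have eq: "{Y. \<forall>i j. a $ i $ j \<le> Y $ i $ j \<and> Y $ i $ j \<le> a $ i $ j + g i} = cbox a ?b"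
    by (auto simp: mem_box B inner_axis)
  show "{Y. \<forall>i j. a $ i $ j \<le> Y $ i $ j \<and> Y $ i $ j \<le> a $ i $ j + g i} \<in> sets borel"
    unfolding eq by simp
  have "\<forall>b\<in>Basis. a \<bullet> b \<le> ?b \<bullet> b"
    unfolding B using assms by (simp add: inner_axis)
  then show "emeasure lborel {Y. \<forall>i j. a $ i $ j \<le> Y $ i $ j \<and> Y $ i $ j \<le> a $ i $ j + g i}
    = ennreal (\<Prod>i\<in>UNIV. g i ^ CARD('c))"
    unfolding eq emeasure_lborel_cbox_eq by (simp add: prod_Basis_rows[symmetric])
qed

text \<open>The set contains all matrices whose row \<open>i0\<close> is approximable, with the other rows free. For fixed
other rows \<open>Y\<close>, the sets \<open>V i\<close> that occur in the slice over \<open>Y\<close> cover all approximable rows, so their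
\<open>r\<^sub>i\<^sup>t\<close> sum to at least a constant. Integrating over \<open>Y\<close> replaces \<open>r\<^sub>i\<^sup>t\<close> by \<open>r\<^sub>i\<^sup>t\<close> times the
volume of those \<open>Y\<close> whose slice meets \<open>V i\<close>, at most \<open>(2 r\<^sub>i)\<^sup>M\<close> with \<open>M\<close> the number of free entries. Each
free entry thus raises the exponent by one.\<close>

lemma cover_sum_lower_bound:
  fixes V :: "nat \<Rightarrow> (real^'c^'r) set"
  assumes N: "CARD('c) = d + 1" and d: "d \<ge> 1" and \<gamma>: "\<gamma> \<ge> 1"
    and t: "0 < t" "t < (real CARD('c) + 1) / (1 + \<gamma> * (1 + real d))"
    and V: "approximable_matrices d \<gamma> \<subseteq> (\<Union>i. V i)"
    and bd: "\<And>i. bounded (V i)" and r: "\<And>i. diameter (V i) \<le> r i" "\<And>i. r i > 0"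
  defines "M \<equiv> (CARD('r) - 1) * CARD('c)"
  shows "ennreal (1 / (4 * 48 ^ CARD('c)) * (1 / 2) powr t / 2 ^ M) \<le> (\<Sum>i. ennreal (r i powr (t + real M)))"
proof -
  define c :: real where "c = 1 / (4 * 48 ^ CARD('c))"
  define c' where "c' = c * (1 / 2) powr t"
  define i0 :: 'r where "i0 = undefined"
  define box where "box = {Y::real^'c^'r. \<forall>i j. 0 $ i $ j \<le> Y $ i $ j \<and> Y $ i $ j \<le> 0 $ i $ j + 1}"
  define v where "v i = (SOME A. A \<in> V i)" for i
  \<comment> \<open>\<open>D k\<close> contains all \<open>Y\<close> in the unit box whose slice meets \<open>V k\<close>. The integration runs over whole matrices; the row \<open>i0\<close> of \<open>Y\<close> is a dummy that contributes the factor 1.\<close>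
  define g where "g k = (\<lambda>i. if i = i0 then 1 else 2 * r k)" for k
  define a where "a k = ((\<chi> i. \<chi> j. if i = i0 then 0 else v k $ i $ j - r k) :: real^'c^'r)" for k
  define D where "D k = {Y. \<forall>i j. a k $ i $ j \<le> Y $ i $ j \<and> Y $ i $ j \<le> a k $ i $ j + g k i}" for k
  have g0: "g k i \<ge> 0" for k i using r(2)[of k] by (simp add: g_def)
  have box: "emeasure lborel box = 1" "box \<in> sets borel"
    unfolding box_def using emeasure_matrix_box[of "\<lambda>_. 1" "0::real^'c^'r"] by auto
  have D: "emeasure lborel (D k) = ennreal ((2 * r k) ^ M)" "D k \<in> sets borel" for k
  proof -
    have "(\<Prod>i\<in>UNIV. g k i ^ CARD('c)) = (\<Prod>i\<in>UNIV - {i0}. (2 * r k) ^ CARD('c))"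
      by (subst prod.remove[of _ i0]) (auto simp: g_def intro!: prod.cong)
    also have "\<dots> = ((2 * r k) ^ CARD('c)) ^ (CARD('r) - 1)" by (simp add: card_Diff_singleton)
    also have "\<dots> = (2 * r k) ^ M" unfolding M_def by (simp only: power_mult[symmetric] mult.commute)
    finally show "emeasure lborel (D k) = ennreal ((2 * r k) ^ M)"
      unfolding D_def by (subst emeasure_matrix_box(1)[OF g0]) simp
    show "D k \<in> sets borel" unfolding D_def by (rule emeasure_matrix_box(2)[OF g0])
  qed
  have entry: "\<bar>A $ i $ j - B $ i $ j\<bar> \<le> r k" if "A \<in> V k" "B \<in> V k" for A B :: "real^'c^'r" and i j k
  proof -
    have "\<bar>A $ i $ j - B $ i $ j\<bar> \<le> norm ((A - B) $ i)"
      using component_le_norm_cart[of "(A - B) $ i" j] by simp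
    also have "\<dots> \<le> dist A B" unfolding dist_norm by (rule Finite_Cartesian_Product.norm_nth_le)
    also have "\<dots> \<le> diameter (V k)" using that bd by (intro diameter_bounded_bound)
    finally show ?thesis using r(1)[of k] by linarith
  qed
  have slice: "ennreal c' \<le> (\<Sum>k. ennreal (r k powr t) * indicator (D k) Y)" if Y: "Y \<in> box" for Y
  proof (rule ccontr)
    assume "\<not> ?thesis"
    then have less: "(\<Sum>k. ennreal (r k powr t) * indicator (D k) Y) < ennreal c'" by simp
    define U where "U k = {x. with_row i0 Y x \<in> V k}" for k
    let ?f = "\<lambda>k. if U k = {} then 0 else r k powr t"
    \<comment> \<open>If the slice sum were small, an approximable row would lie outside every slice.\<close>
    have "(\<Sum>k. ennreal (?f k)) \<le> (\<Sum>k. ennreal (r k powr t) * indicator (D k) Y)"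
    proof (intro suminf_le summableI)
      fix k
      have "Y \<in> D k" if "U k \<noteq> {}"
      proof -
        from that obtain x where x: "with_row i0 Y x \<in> V k" by (auto simp: U_def)
        then have vk: "v k \<in> V k" unfolding v_def by (rule someI)
        have "a k $ i $ j \<le> Y $ i $ j \<and> Y $ i $ j \<le> a k $ i $ j + g k i" for i j
        proof (cases "i = i0")
          case True
          then show ?thesis using Y by (simp add: a_def g_def box_def)
        next
          case False
          then show ?thesis using entry[OF x vk, of i j] by (simp add: a_def g_def with_row_def abs_le_iff)
        qed
        then show ?thesis by (simp add: D_def)
      qed
      then show "ennreal (?f k) \<le> ennreal (r k powr t) * indicator (D k) Y" by auto
    qed
    then have lt: "(\<Sum>k. ennreal (?f k)) < ennreal c'" using less by (rule le_less_trans)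
    have f0: "?f k \<ge> 0" for k by simp
    have sm: "summable ?f"
      by (rule summable_suminf_not_top[OF f0])
        (use order.strict_trans[OF lt ennreal_less_top] in \<open>simp only: less_top\<close>)
    have "(\<Sum>k. ?f k) < c'"
      using lt suminf_ennreal2[OF f0 sm] by (simp add: ennreal_less_iff suminf_nonneg[OF sm f0])
    then have total: "(\<Sum>k. ?f k) < c * (1 / 2) powr t" by (simp add: c'_def)
    have \<tau>: "\<gamma> * (1 + real d) \<ge> 1"
      using mult_mono[of 1 \<gamma> 1 "1 + real d"] \<gamma> by simp
    have diff: "\<forall>k. \<forall>x\<in>U k. \<forall>y\<in>U k. \<forall>j. \<bar>x $ j - y $ j\<bar> \<le> r k"
    proof (intro allI ballI)
      fix k x y j assume "x \<in> U k" "y \<in> U k"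
      then show "\<bar>x $ j - y $ j\<bar> \<le> r k"
        using entry[of "with_row i0 Y x" k "with_row i0 Y y" i0 j] by (simp add: U_def with_row_def)
    qed
    have N2: "CARD('c) \<ge> 2" using N d by simp
    obtain x where x: "x \<in> cube (\<chi> j. 1 / 2) (1 / 2)" and out: "\<forall>k. x \<notin> U k"
      and inf: "infinite {k::nat. \<forall>j. dist_nearest_int (real k * x $ j) < real k powr - (\<gamma> * (1 + real d))}"
      by (rule approximable_point_outside_cover[OF N2 r(2) diff sm \<tau> t c_def total])
    have "with_row i0 Y x \<in> approximable_matrices d \<gamma>"
      by (rule with_row_approximable[OF x _ inf]) (use Y in \<open>simp add: box_def\<close>)
    then show False using V out by (auto simp: U_def)
  qed
  have "ennreal c' = (\<integral>\<^sup>+Y. ennreal c' * indicator box Y \<partial>lborel)"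
    using box by (subst nn_integral_cmult_indicator) auto
  also have "\<dots> \<le> (\<integral>\<^sup>+Y. (\<Sum>k. ennreal (r k powr t) * indicator (D k) Y) \<partial>lborel)"
    by (intro nn_integral_mono) (use slice in \<open>auto simp: indicator_def\<close>)
  also have "\<dots> = (\<Sum>k. \<integral>\<^sup>+Y. ennreal (r k powr t) * indicator (D k) Y \<partial>lborel)"
    using D(2) by (intro nn_integral_suminf) auto
  also have "\<dots> = (\<Sum>k. ennreal (r k powr t) * ennreal ((2 * r k) ^ M))"
    using D by (subst nn_integral_cmult_indicator) auto
  also have "\<dots> = (\<Sum>k. ennreal (2 ^ M) * ennreal (r k powr (t + real M)))"
  proof (intro suminf_cong)
    fix k
    have "r k powr t * (2 * r k) ^ M = 2 ^ M * r k powr (t + real M)"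
      using r(2)[of k] by (simp add: power_mult_distrib powr_add powr_realpow)
    then show "ennreal (r k powr t) * ennreal ((2 * r k) ^ M) = ennreal (2 ^ M) * ennreal (r k powr (t + real M))"
      using r(2)[of k] by (simp add: ennreal_mult[symmetric] less_imp_le)
  qed
  also have "\<dots> = ennreal (2 ^ M) * (\<Sum>k. ennreal (r k powr (t + real M)))" by simp
  finally have le: "ennreal c' \<le> ennreal (2 ^ M) * (\<Sum>k. ennreal (r k powr (t + real M)))" .
  have c'0: "c' \<ge> 0" by (simp add: c'_def c_def)
  have "ennreal (c' / 2 ^ M) = ennreal (1 / 2 ^ M) * ennreal c'" 
    using c'0 by (simp add: ennreal_mult[symmetric])
  also have "\<dots> \<le> ennreal (1 / 2 ^ M) * (ennreal (2 ^ M) * (\<Sum>k. ennreal (r k powr (t + real M))))"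
    by (rule mult_left_mono[OF le]) simp
  also have "\<dots> = (ennreal (1 / 2 ^ M) * ennreal (2 ^ M)) * (\<Sum>k. ennreal (r k powr (t + real M)))"
    by (simp only: mult.assoc)
  also have "ennreal (1 / 2 ^ M) * ennreal (2 ^ M) = 1"
    by (subst ennreal_mult[symmetric]) auto
  finally show ?thesis by (simp add: c'_def c_def)
qed

section \<open>Hausdorff measure from finite sums\<close>

text \<open>Covers may be indexed by any countable type, and a bound for all finite partial sums suffices.
This avoids enumerating the pairs of an integer vector and a grid cell.\<close>

lemma hausdorff_premeasure_le:
  fixes U :: "'i::countable \<Rightarrow> 'a::metric_space set"
  assumes E: "E \<subseteq> (\<Union>i. U i)" and U: "\<And>i. bounded (U i)" "\<And>i. diameter (U i) \<le> \<delta>"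
    and "\<delta> \<ge> 0" and sums: "\<And>F. finite F \<Longrightarrow> (\<Sum>i\<in>F. diam_power s (U i)) \<le> C"
  shows "hausdorff_premeasure s \<delta> E \<le> C"
proof -
  define V where "V n = (if n \<in> range (to_nat :: 'i \<Rightarrow> nat) then U (from_nat n) else {})" for n
  have "E \<subseteq> (\<Union>n. V n)"
  proof
    fix x assume "x \<in> E"
    then obtain i where "x \<in> U i" using E by auto
    then have "x \<in> V (to_nat i)" by (simp add: V_def)
    then show "x \<in> (\<Union>n. V n)" by blast
  qed
  moreover have "bounded (V n) \<and> diameter (V n) \<le> \<delta>" for n using U assms(4) by (simp add: V_def)
  ultimately have "hausdorff_premeasure s \<delta> E \<le> (\<Sum>n. diam_power s (V n))"
    unfolding hausdorff_premeasure_def by (intro INF_lower) auto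
  also have "\<dots> \<le> C"
    unfolding suminf_eq_SUP
  proof (rule SUP_least)
    fix n
    let ?F = "(from_nat :: nat \<Rightarrow> 'i) ` ({..<n} \<inter> range (to_nat :: 'i \<Rightarrow> nat))"
    have inj: "inj_on (from_nat :: nat \<Rightarrow> 'i) ({..<n} \<inter> range (to_nat :: 'i \<Rightarrow> nat))"
      by (rule inj_onI) auto
    have "(\<Sum>k<n. diam_power s (V k)) = (\<Sum>k\<in>{..<n} \<inter> range (to_nat :: 'i \<Rightarrow> nat). diam_power s (U (from_nat k)))"
      by (rule sum.mono_neutral_cong_right) (auto simp: V_def diam_power_def)
    also have "\<dots> = (\<Sum>i\<in>?F. diam_power s (U i))"
      by (subst sum.reindex[OF inj]) simp
    also have "\<dots> \<le> C" by (rule sums) simp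
    finally show "(\<Sum>k<n. diam_power s (V k)) \<le> C" .
  qed
  finally show ?thesis .
qed

lemma hausdorff_premeasure_antimono:
  "\<delta> \<le> \<delta>' \<Longrightarrow> hausdorff_premeasure s \<delta>' E \<le> hausdorff_premeasure s \<delta> E"
  unfolding hausdorff_premeasure_def by (rule INF_superset_mono) (auto intro: order.trans)

lemma hausdorff_measure_zeroI:
  assumes "e > 0" "C \<ge> 0"
    and le: "\<And>\<delta>. 0 < \<delta> \<Longrightarrow> hausdorff_premeasure s \<delta> E \<le> ennreal (C * \<delta> powr e)"
  shows "hausdorff_measure s E = 0"
proof -
  have zero: "hausdorff_premeasure s \<delta> E = 0" if \<delta>: "\<delta> > 0" for \<delta>
  proof -
    have "hausdorff_premeasure s \<delta> E \<le> ennreal \<eta>" if \<eta>: "\<eta> > 0" for \<eta>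
    proof -
      define \<delta>' where "\<delta>' = min \<delta> ((\<eta> / (C + 1)) powr (1 / e))"
      have \<delta>': "\<delta>' > 0" "\<delta>' \<le> \<delta>" using \<delta> \<eta> assms by (auto simp: \<delta>'_def)
      have "\<delta>' powr e \<le> ((\<eta> / (C + 1)) powr (1 / e)) powr e"
        using \<delta>' assms by (intro powr_mono2) (auto simp: \<delta>'_def)
      also have "\<dots> = \<eta> / (C + 1)" using \<eta> assms by (simp add: powr_powr)
      finally have "C * \<delta>' powr e \<le> (C + 1) * (\<eta> / (C + 1))" using assms by (intro mult_mono) auto
      also have "\<dots> = \<eta>" using assms by simp
      finally have "C * \<delta>' powr e \<le> \<eta>" .
      have "hausdorff_premeasure s \<delta> E \<le> hausdorff_premeasure s \<delta>' E"
        by (rule hausdorff_premeasure_antimono) (rule \<delta>')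
      also have "\<dots> \<le> ennreal (C * \<delta>' powr e)" by (rule le) (rule \<delta>')
      also have "\<dots> \<le> ennreal \<eta>" by (rule ennreal_leI) fact
      finally show ?thesis .
    qed
    then have "hausdorff_premeasure s \<delta> E \<le> 0 + ennreal \<eta>" if "\<eta> > 0" for \<eta>
      using that by simp
    then have "hausdorff_premeasure s \<delta> E \<le> 0"
      by (rule ennreal_le_epsilon)
    then show ?thesis by simp
  qed
  have "hausdorff_measure s E \<le> 0"
    unfolding hausdorff_measure_def by (rule SUP_least) (simp add: zero)
  then show ?thesis by simp
qed

section \<open>Summation of the heights\<close>

lemma sum_int_abs_le:
  fixes S :: "int set"
  assumes "finite S" "summable f" "\<And>n. f n \<ge> (0::real)"
  shows "(\<Sum>k\<in>S. f (nat \<bar>k\<bar>)) \<le> 2 * (\<Sum>n. f n)"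
proof -
  have part: "(\<Sum>k\<in>T. f (nat \<bar>k\<bar>)) \<le> (\<Sum>n. f n)" if "finite T" "inj_on (\<lambda>k. nat \<bar>k\<bar>) T" for T :: "int set"
  proof -
    have "(\<Sum>k\<in>T. f (nat \<bar>k\<bar>)) = (\<Sum>n\<in>(\<lambda>k. nat \<bar>k\<bar>) ` T. f n)"
      by (subst sum.reindex[OF that(2)]) simp
    also have "\<dots> \<le> (\<Sum>n. f n)" using that assms by (intro sum_le_suminf) auto
    finally show ?thesis .
  qed
  have "S = {k\<in>S. k \<ge> 0} \<union> {k\<in>S. k < 0}" by auto
  then have "(\<Sum>k\<in>S. f (nat \<bar>k\<bar>)) = (\<Sum>k\<in>{k\<in>S. k \<ge> 0}. f (nat \<bar>k\<bar>)) + (\<Sum>k\<in>{k\<in>S. k < 0}. f (nat \<bar>k\<bar>))"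
    using assms by (subst sum.union_disjoint[symmetric]) auto
  also have "\<dots> \<le> (\<Sum>n. f n) + (\<Sum>n. f n)"
    using assms by (intro add_mono part) (auto intro!: inj_onI)
  finally show ?thesis by simp
qed

text \<open>The height is a product over the coordinates, so over a box of integer vectors the sum factors
into one-dimensional sums, each bounded by a convergent series.\<close>

lemma height_sum_bounded:
  assumes "a > 1"
  shows "\<exists>Z\<ge>0. \<forall>F. finite F \<longrightarrow> (\<Sum>q\<in>F. height (q :: int^'r) powr - a) \<le> Z"
proof -
  define f where "f n = max 1 (real n) powr - a" for n :: nat
  have sm: "summable f"
  proof (rule summable_comparison_test_ev)
    show "\<forall>\<^sub>F n in sequentially. norm (f n) \<le> real n powr - a"
      using eventually_ge_at_top[of 1] by eventually_elim (simp add: f_def max_def)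
    show "summable (\<lambda>n. real n powr - a)" using assms by (simp add: summable_real_powr_iff)
  qed
  have f0: "f n \<ge> 0" for n by (simp add: f_def)
  have height: "height (q :: int^'r) powr - a = (\<Prod>j\<in>UNIV. f (nat \<bar>q $ j\<bar>))" for q
    unfolding height_def f_def by (subst prod_powr_distrib) auto
  have "(\<Sum>q\<in>F. height (q :: int^'r) powr - a) \<le> (2 * suminf f) ^ CARD('r)" if F: "finite F" for F
  proof -
    define S where "S = (\<Union>j. (\<lambda>q. q $ j) ` F)"
    have S: "finite S" using F by (simp add: S_def)
    have inj: "inj_on (vec_lambda :: ('r \<Rightarrow> int) \<Rightarrow> int^'r) (\<Pi>\<^sub>E j\<in>UNIV. S)" by (simp add: inj_on_def vec_lambda_inject)
    have sub: "F \<subseteq> vec_lambda ` (\<Pi>\<^sub>E j\<in>UNIV. S)"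
    proof
      fix q assume "q \<in> F"
      then have "vec_nth q \<in> (\<Pi>\<^sub>E j\<in>UNIV. S)" by (auto simp: S_def)
      then show "q \<in> vec_lambda ` (\<Pi>\<^sub>E j\<in>UNIV. S)" by (metis image_eqI vec_lambda_eta)
    qed
    have "(\<Sum>q\<in>F. height q powr - a) \<le> (\<Sum>q\<in>vec_lambda ` (\<Pi>\<^sub>E j\<in>UNIV. S). height (q :: int^'r) powr - a)"
      using S by (intro sum_mono2 sub finite_imageI finite_PiE) auto
    also have "\<dots> = (\<Sum>g\<in>(\<Pi>\<^sub>E j\<in>(UNIV :: 'r set). S). \<Prod>j\<in>UNIV. f (nat \<bar>g j\<bar>))"
      by (subst sum.reindex[OF inj]) (simp add: height)
    also have "\<dots> = (\<Prod>j\<in>(UNIV :: 'r set). \<Sum>k\<in>S. f (nat \<bar>k\<bar>))"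
      using S by (subst prod_sum_PiE) auto
    also have "\<dots> \<le> (\<Prod>j\<in>(UNIV :: 'r set). 2 * suminf f)"
      using sum_int_abs_le[OF S sm f0] f0 by (intro prod_mono) (auto intro: sum_nonneg)
    finally show ?thesis by simp
  qed
  moreover have "(2 * suminf f) ^ CARD('r) \<ge> 0" using suminf_nonneg[OF sm f0] by simp
  ultimately show ?thesis by blast
qed

lemma max_abs_ge: "\<bar>real_of_int (q $ j)\<bar> \<le> max_abs q"
  unfolding max_abs_def by (rule Max_ge) auto

lemma max_abs_attained: obtains j where "max_abs q = \<bar>real_of_int (q $ j)\<bar>"
proof -
  have "max_abs q \<in> range (\<lambda>j. real_of_int \<bar>q $ j\<bar>)" unfolding max_abs_def by (rule Max_in) auto
  then show thesis using that by auto
qed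

lemma max_abs_ge_1:
  assumes "max_abs q \<noteq> 0"
  shows "max_abs q \<ge> 1"
proof -
  obtain j where j: "max_abs q = \<bar>real_of_int (q $ j)\<bar>" by (rule max_abs_attained)
  then have "q $ j \<noteq> 0" using assms by auto
  then have "\<bar>q $ j\<bar> \<ge> 1" by linarith
  then show ?thesis using j by linarith
qed

lemma height_ge_1: "height q \<ge> 1"
  unfolding height_def by (rule prod_ge_1) simp

lemma max_abs_le_height: "max_abs q \<le> height q"
proof -
  obtain j where j: "max_abs q = \<bar>real_of_int (q $ j)\<bar>" by (rule max_abs_attained)
  have "height q = max 1 (real_of_int \<bar>q $ j\<bar>) * (\<Prod>i\<in>UNIV - {j}. max 1 (real_of_int \<bar>q $ i\<bar>))"
    unfolding height_def by (rule prod.remove) auto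
  also have "\<dots> \<ge> max 1 (real_of_int \<bar>q $ j\<bar>) * 1"
    by (intro mult_left_mono prod_ge_1) auto
  finally show ?thesis using j by simp
qed

lemma height_le_max_abs_power:
  fixes q :: "int^'r"
  assumes "max_abs q \<ge> 1"
  shows "height q \<le> max_abs q ^ CARD('r)"
proof -
  have "height q \<le> (\<Prod>j\<in>(UNIV :: 'r set). max_abs q)"
    unfolding height_def using max_abs_ge[of q] assms by (intro prod_mono) auto
  then show ?thesis by simp
qed

section \<open>Counting cells\<close>

text \<open>The cells of the grid of mesh \<open>\<delta>\<close> in the unit cube that contain a point whose scalar product
with \<open>q\<close> is \<open>\<psi>\<close>-close to an integer, that is, which meet a neighbourhood of the resonant hyperplanes.\<close>

definition near_integer_cells :: "int^'r \<Rightarrow> real \<Rightarrow> real \<Rightarrow> (int^'r) set" where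
  "near_integer_cells q \<psi> \<delta> = {k. \<exists>a. (\<forall>i. a i \<in> {0..1} \<and> k $ i = \<lfloor>a i / \<delta>\<rfloor>)
     \<and> dist_nearest_int (\<Sum>i\<in>UNIV. of_int (q $ i) * a i) < \<psi>}"

text \<open>The mesh \<open>\<psi> / \<bar>q\<bar>\<close> is the width of the neighbourhoods of the hyperplanes \<open>q \<bullet> a = p\<close>. There are
\<open>O(\<bar>q\<bar>)\<close> values of \<open>p\<close>. Choose \<open>i0\<close> with \<open>\<bar>q\<^sub>i\<^sub>0\<bar> = \<bar>q\<bar>\<close>: the other \<open>m - 1\<close> grid coordinates are free,
\<open>O(1 / \<delta>)\<close> values each, and together with \<open>p\<close> they confine the coordinate \<open>i0\<close> to boundedly many values.\<close>

lemma card_near_integer_cells: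
  fixes q :: "int^'r"
  assumes Q: "max_abs q \<ge> 1" and \<psi>: "0 < \<psi>" "\<psi> \<le> 1" and \<delta>: "\<delta> = \<psi> / max_abs q"
  shows "finite (near_integer_cells q \<psi> \<delta>)"
    and "real (card (near_integer_cells q \<psi> \<delta>))
      \<le> (2 * real CARD('r) + 3) ^ 2 * max_abs q * (2 / \<delta>) ^ (CARD('r) - 1)"
proof -
  let ?m = "CARD('r)" and ?Q = "max_abs q"
  have \<delta>0: "\<delta> > 0" "\<delta> \<le> 1" using assms by (auto simp: divide_le_eq)
  have \<delta>Q: "?Q * \<delta> = \<psi>" using assms by simp
  obtain i0 where i0: "?Q = \<bar>real_of_int (q $ i0)\<bar>" by (rule max_abs_attained)
  define P where "P = {p::int. \<bar>of_int p - 0\<bar> \<le> real ?m * ?Q + 1}"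
  have wP: "real ?m * ?Q + 1 \<ge> 0" using Q by simp
  have finP: "finite P" unfolding P_def by (rule card_int_near(1)[OF wP])
  have "real (card P) \<le> 2 * (real ?m * ?Q + 1) + 1"
    unfolding P_def by (rule card_int_near(2)[OF wP])
  also have "\<dots> \<le> (2 * real ?m + 3) * ?Q" using Q by (simp add: algebra_simps)
  finally have cardP: "real (card P) \<le> (2 * real ?m + 3) * ?Q" .
  define I where "I = {x::int. \<bar>of_int x - 1 / (2 * \<delta>)\<bar> \<le> 1 / (2 * \<delta>)}"
  have wI: "1 / (2 * \<delta>) \<ge> 0" using \<delta>0 by simp
  have finI: "finite I" unfolding I_def by (rule card_int_near(1)[OF wI])
  have "1 \<le> 1 / \<delta>" using \<delta>0 by simp
  then have cardI: "real (card I) \<le> 2 / \<delta>"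
    using card_int_near(2)[OF wI, of "1 / (2 * \<delta>)"] unfolding I_def by simp
  let ?K = "\<lambda>i. if i = i0 then {0} else I"
  define K where "K = {k::int^'r. \<forall>i. k $ i \<in> ?K i}"
  have finK: "finite K" unfolding K_def by (rule card_vec_coords) (use finI in simp)
  have "real (card K) = (\<Prod>i\<in>UNIV. real (card (?K i)))"
    unfolding K_def by (subst card_vec_coords(2)) (use finI in simp_all)
  also have "\<dots> = (\<Prod>i\<in>UNIV - {i0}. real (card I))"
    by (subst prod.remove[of _ i0]) (auto intro!: prod.cong)
  also have "\<dots> = real (card I) ^ (?m - 1)" by (simp add: card_Diff_singleton)
  also have "\<dots> \<le> (2 / \<delta>) ^ (?m - 1)" by (intro power_mono cardI) simp
  finally have cardK: "real (card K) \<le> (2 / \<delta>) ^ (?m - 1)" .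
  \<comment> \<open>The position of the coordinate \<open>i0\<close> forced by \<open>p\<close> and the other coordinates of the cell.\<close>
  define base where "base p k = (of_int p - (\<Sum>i\<in>UNIV - {i0}. of_int (q $ i) * (\<delta> * of_int (k $ i)))) / (of_int (q $ i0) * \<delta>)"
    for p :: int and k :: "int^'r"
  let ?T = "\<lambda>p k i. if i = i0 then {x::int. \<bar>of_int x - base p k\<bar> \<le> real ?m + 1} else {k $ i}"
  define T where "T p k = {k'::int^'r. \<forall>i. k' $ i \<in> ?T p k i}" for p k
  have finT': "finite (?T p k i)" for p k i
    using card_int_near(1)[of "real ?m + 1" "base p k"] by simp
  have finT: "finite (T p k)" for p k unfolding T_def by (rule card_vec_coords(1)[OF finT'])
  have cardT: "real (card (T p k)) \<le> 2 * real ?m + 3" for p k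
  proof -
    have "real (card (T p k)) = (\<Prod>i\<in>UNIV. real (card (?T p k i)))"
      unfolding T_def by (subst card_vec_coords(2)[OF finT']) simp
    also have "\<dots> = real (card {x::int. \<bar>of_int x - base p k\<bar> \<le> real ?m + 1})"
      by (subst prod.remove[of _ i0]) auto
    also have "\<dots> \<le> 2 * (real ?m + 1) + 1" by (rule card_int_near(2)) simp
    finally show ?thesis by simp
  qed
  have sub: "near_integer_cells q \<psi> \<delta> \<subseteq> (\<Union>(p, k)\<in>P \<times> K. T p k)"
  proof
    fix k assume "k \<in> near_integer_cells q \<psi> \<delta>"
    then obtain a where a: "\<And>i. a i \<in> {0..1}" and k: "\<And>i. k $ i = \<lfloor>a i / \<delta>\<rfloor>"
      and near: "dist_nearest_int (\<Sum>i\<in>UNIV. of_int (q $ i) * a i) < \<psi>"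
      by (auto simp: near_integer_cells_def)
    define p where "p = round (\<Sum>i\<in>UNIV. of_int (q $ i) * a i)"
    have p: "\<bar>(\<Sum>i\<in>UNIV. of_int (q $ i) * a i) - of_int p\<bar> < \<psi>"
      using near by (simp add: p_def dist_nearest_int_def)
    have "\<bar>\<Sum>i\<in>UNIV. of_int (q $ i) * a i\<bar> \<le> (\<Sum>i\<in>UNIV. \<bar>of_int (q $ i) * a i\<bar>)" by (rule sum_abs)
    also have "\<dots> \<le> (\<Sum>i\<in>(UNIV :: 'r set). ?Q * 1)"
      unfolding abs_mult using a Q by (intro sum_mono mult_mono max_abs_ge) auto
    finally have "\<bar>\<Sum>i\<in>UNIV. of_int (q $ i) * a i\<bar> \<le> real ?m * ?Q" by simp
    then have pP: "p \<in> P" using p \<psi> unfolding P_def mem_Collect_eq by linarith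
    have k_bounds: "\<bar>a i - \<delta> * of_int (k $ i)\<bar> \<le> \<delta>" "k $ i \<in> I" for i
    proof -
      have "of_int (k $ i) \<le> a i / \<delta>" "a i / \<delta> \<le> of_int (k $ i) + 1" unfolding k by linarith+
      then have le: "\<delta> * of_int (k $ i) \<le> a i" "a i \<le> \<delta> * of_int (k $ i) + \<delta>"
        using \<delta>0 by (auto simp: field_simps)
      then show "\<bar>a i - \<delta> * of_int (k $ i)\<bar> \<le> \<delta>" by linarith
      have "0 \<le> k $ i" unfolding k using a[of i] \<delta>0 by simp
      moreover have "of_int (k $ i) \<le> 1 / \<delta>" using le(1) a[of i] \<delta>0 by (auto simp: field_simps)
      moreover have "2 * (1 / (2 * \<delta>)) = 1 / \<delta>" by simp
      ultimately show "k $ i \<in> I" unfolding I_def mem_Collect_eq abs_le_iff by linarith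
    qed
    \<comment> \<open>In \<open>K\<close> the coordinate \<open>i0\<close> is normalised to 0; \<open>base\<close> does not depend on it.\<close>
    define k' where "k' = (\<chi> i. if i = i0 then 0 else k $ i)"
    have k'K: "k' \<in> K" using k_bounds by (simp add: K_def k'_def)
    have "\<bar>of_int (k $ i0) - base p k'\<bar> \<le> real ?m + 1"
    proof -
      let ?s = "\<Sum>i\<in>UNIV. of_int (q $ i) * (\<delta> * of_int (k $ i)) :: real"
      have q0: "real_of_int (q $ i0) \<noteq> 0" using i0 Q by auto
      have s: "?s = of_int (q $ i0) * (\<delta> * of_int (k $ i0))
          + (\<Sum>i\<in>UNIV - {i0}. of_int (q $ i) * (\<delta> * of_int (k' $ i)))"
        by (subst sum.remove[of _ i0]) (auto simp: k'_def intro!: sum.cong)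
      have "\<bar>(\<Sum>i\<in>UNIV. of_int (q $ i) * a i) - ?s\<bar> = \<bar>\<Sum>i\<in>UNIV. of_int (q $ i) * (a i - \<delta> * of_int (k $ i))\<bar>"
        by (simp add: sum_subtractf[symmetric] right_diff_distrib)
      also have "\<dots> \<le> (\<Sum>i\<in>UNIV. \<bar>of_int (q $ i) * (a i - \<delta> * of_int (k $ i))\<bar>)" by (rule sum_abs)
      also have "\<dots> \<le> (\<Sum>i\<in>(UNIV :: 'r set). ?Q * \<delta>)"
        unfolding abs_mult using k_bounds Q by (intro sum_mono mult_mono max_abs_ge) auto
      also have "\<dots> = real ?m * \<psi>" by (simp add: \<delta>Q)
      finally have "\<bar>?s - of_int p\<bar> \<le> (real ?m + 1) * \<psi>" using p unfolding distrib_right by linarith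
      moreover have "?s - of_int p = (of_int (q $ i0) * \<delta>) * (of_int (k $ i0) - base p k')"
        unfolding s base_def using q0 \<delta>0 by (simp add: field_simps)
      ultimately have "\<bar>of_int (q $ i0) * \<delta>\<bar> * \<bar>of_int (k $ i0) - base p k'\<bar> \<le> (real ?m + 1) * \<psi>"
        by (simp add: abs_mult)
      moreover have "\<bar>of_int (q $ i0) * \<delta>\<bar> = \<psi>" using \<delta>0 \<delta>Q i0 by (simp add: abs_mult)
      ultimately show ?thesis using \<psi> by (simp add: mult.commute)
    qed
    then have "k \<in> T p k'" by (simp add: T_def k'_def)
    then show "k \<in> (\<Union>(p, k)\<in>P \<times> K. T p k)" using pP k'K by blast
  qed
  have finU: "finite (\<Union>(p, k)\<in>P \<times> K. T p k)" using finP finK finT by auto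
  show "finite (near_integer_cells q \<psi> \<delta>)" using finite_subset[OF sub finU] .
  have "card (near_integer_cells q \<psi> \<delta>) \<le> card (\<Union>(p, k)\<in>P \<times> K. T p k)"
    by (rule card_mono[OF finU sub])
  also have "\<dots> \<le> (\<Sum>x\<in>P \<times> K. card (case x of (p, k) \<Rightarrow> T p k))"
    using finP finK by (intro card_UN_le) simp
  finally have "real (card (near_integer_cells q \<psi> \<delta>)) \<le> (\<Sum>x\<in>P \<times> K. real (card (case x of (p, k) \<Rightarrow> T p k)))"
    unfolding of_nat_sum[symmetric] of_nat_le_iff .
  also have "\<dots> \<le> (\<Sum>x\<in>P \<times> K. 2 * real ?m + 3)"
    using cardT by (intro sum_mono) (simp add: case_prod_unfold)
  also have "\<dots> = real (card P) * real (card K) * (2 * real ?m + 3)"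
    by (simp add: card_cartesian_product)
  also have "\<dots> \<le> ((2 * real ?m + 3) * ?Q) * (2 / \<delta>) ^ (?m - 1) * (2 * real ?m + 3)"
    using Q by (intro mult_right_mono mult_mono cardP cardK) auto
  also have "\<dots> = (2 * real ?m + 3) ^ 2 * ?Q * (2 / \<delta>) ^ (?m - 1)"
    by (simp add: power2_eq_square)
  finally show "real (card (near_integer_cells q \<psi> \<delta>)) \<le> (2 * real ?m + 3) ^ 2 * ?Q * (2 / \<delta>) ^ (?m - 1)" .
qed

definition matrix_cell :: "real \<Rightarrow> int^'c^'r \<Rightarrow> (real^'c^'r) set" where
  "matrix_cell \<delta> K = {A. \<forall>i j. \<lfloor>A $ i $ j / \<delta>\<rfloor> = K $ i $ j}"

lemma matrix_cell_diameter:
  fixes K :: "int^'c^'r"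
  assumes "\<delta> > 0"
  shows "bounded (matrix_cell \<delta> K)" and "diameter (matrix_cell \<delta> K) \<le> real CARD('r) * real CARD('c) * \<delta>"
proof -
  have norm_le: "norm (A - B) \<le> real CARD('r) * real CARD('c) * \<delta>"
    if A: "A \<in> matrix_cell \<delta> K" and B: "B \<in> matrix_cell \<delta> K" for A B
  proof -
    have entry: "\<bar>(A - B) $ i $ j\<bar> \<le> \<delta>" for i j
    proof -
      have "\<lfloor>A $ i $ j / \<delta>\<rfloor> = \<lfloor>B $ i $ j / \<delta>\<rfloor>" using A B by (simp add: matrix_cell_def)
      then have "\<bar>A $ i $ j / \<delta> - B $ i $ j / \<delta>\<bar> \<le> 1" by linarith
      moreover have "A $ i $ j / \<delta> - B $ i $ j / \<delta> = (A - B) $ i $ j / \<delta>" by (simp add: diff_divide_distrib)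
      ultimately show ?thesis using assms by (simp add: divide_le_eq)
    qed
    have "norm (A - B) \<le> (\<Sum>i\<in>UNIV. norm ((A - B) $ i))"
      unfolding norm_vec_def[of "A - B"] by (rule L2_set_le_sum) simp
    also have "\<dots> \<le> (\<Sum>i\<in>(UNIV :: 'r set). \<Sum>j\<in>UNIV. \<bar>(A - B) $ i $ j\<bar>)"
      by (intro sum_mono norm_le_l1_cart)
    also have "\<dots> \<le> (\<Sum>i\<in>(UNIV :: 'r set). \<Sum>j\<in>(UNIV :: 'c set). \<delta>)"
      by (intro sum_mono entry)
    finally show ?thesis by simp
  qed
  show "diameter (matrix_cell \<delta> K) \<le> real CARD('r) * real CARD('c) * \<delta>"
    using assms by (intro diameter_le norm_le) auto
  show "bounded (matrix_cell \<delta> K)"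
    unfolding bounded_any_center[of _ undefined]
  proof (cases "matrix_cell \<delta> K = {}")
    case False
    then obtain B where "B \<in> matrix_cell \<delta> K" by auto
    then show "\<exists>e. \<forall>y\<in>matrix_cell \<delta> K. dist undefined y \<le> e"
      using norm_le bounded_any_center[of "matrix_cell \<delta> K" undefined] bounded_any_center[of "matrix_cell \<delta> K" B]
      by (metis dist_norm)
  qed simp
qed

lemma card_matrix_cells:
  fixes S :: "(int^'r) set"
  assumes "finite S"
  shows "finite {K::int^'c^'r. \<forall>j. column j K \<in> S}"
    and "card {K::int^'c^'r. \<forall>j. column j K \<in> S} \<le> card S ^ CARD('c)"
proof -
  let ?V = "{v::(int^'r)^'c. \<forall>j. v $ j \<in> S}"
  have sub: "transpose ` {K::int^'c^'r. \<forall>j. column j K \<in> S} \<subseteq> ?V"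
    by (auto simp: transpose_def column_def)
  have inj: "inj_on transpose {K::int^'c^'r. \<forall>j. column j K \<in> S}"
    by (rule inj_onI) (metis transpose_transpose)
  have fin: "finite ?V" by (rule card_vec_coords(1)[OF assms])
  show "finite {K::int^'c^'r. \<forall>j. column j K \<in> S}"
    using finite_subset[OF sub fin] inj by (rule finite_imageD)
  have "card {K::int^'c^'r. \<forall>j. column j K \<in> S} \<le> card ?V" by (rule card_inj_on_le[OF inj sub fin])
  also have "\<dots> = card S ^ CARD('c)" by (subst card_vec_coords(2)[OF assms]) simp
  finally show "card {K::int^'c^'r. \<forall>j. column j K \<in> S} \<le> card S ^ CARD('c)" .
qed

section \<open>The upper bound\<close>

definition approx_radius :: "nat \<Rightarrow> real \<Rightarrow> int^'r \<Rightarrow> real" where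
  "approx_radius d \<gamma> q = height q powr - \<gamma> * max_abs q powr - (\<gamma> * real d)"

text \<open>Substituting \<open>\<bar>q\<bar> = H\<^bsup>\<sigma>\<^sub>2\<^esup>\<close> into \<open>H\<^bsup>-\<sigma>\<^sub>1\<^esup>\<close> eliminates both exponents. At height 1 this holds
as well, both sides being 1, while the zero vector satisfies no such equation.\<close>

lemma approx_radius_eq:
  assumes "max_abs q = height q powr \<sigma>\<^sub>2" "\<sigma>\<^sub>1 = \<gamma> * (1 + real d * \<sigma>\<^sub>2)"
  shows "max_abs q \<ge> 1" and "height q powr - \<sigma>\<^sub>1 = approx_radius d \<gamma> q"
proof -
  have h: "height q \<ge> 1" by (rule height_ge_1)
  then show "max_abs q \<ge> 1" using assms(1) by (intro max_abs_ge_1) simp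
  have "height q powr - \<sigma>\<^sub>1 = height q powr - \<gamma> * height q powr (\<sigma>\<^sub>2 * - (\<gamma> * real d))"
    unfolding powr_add[symmetric] assms(2) by (simp add: algebra_simps)
  also have "height q powr (\<sigma>\<^sub>2 * - (\<gamma> * real d)) = max_abs q powr - (\<gamma> * real d)"
    unfolding assms(1) by (simp add: powr_powr)
  finally show "height q powr - \<sigma>\<^sub>1 = approx_radius d \<gamma> q" by (simp add: approx_radius_def)
qed

lemma approx_radius_bounds:
  assumes "max_abs q \<ge> 1" "\<gamma> \<ge> 0"
  shows "0 < approx_radius d \<gamma> q" "approx_radius d \<gamma> q \<le> 1"
proof -
  have H: "height q \<ge> 1" by (rule height_ge_1)
  show "0 < approx_radius d \<gamma> q" using H assms by (simp add: approx_radius_def)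
  have "height q powr - \<gamma> \<le> 1" "max_abs q powr - (\<gamma> * real d) \<le> 1"
    using H assms powr_mono[of "- \<gamma>" 0 "height q"] powr_mono[of "- (\<gamma> * real d)" 0 "max_abs q"] by auto
  then show "approx_radius d \<gamma> q \<le> 1" unfolding approx_radius_def by (intro mult_le_one) auto
qed

text \<open>The hypothesis \<open>\<gamma> t \<ge> 1\<close> holds for \<open>t\<close> above the critical value because \<open>\<gamma> \<ge> 1\<close>. The power of \<open>Q\<close> on
the left is \<open>d + 1 - t (1 + \<gamma> d) = (\<gamma> t - 1) - \<eta>\<close>. Its nonnegative first part gives at most the same
power of \<open>H \<ge> Q\<close>, which together with \<open>H\<^bsup>-\<gamma>t\<^esup>\<close> leaves \<open>H\<^sup>-\<^sup>1\<close>; the surplus \<open>Q\<^bsup>-\<eta>\<^esup> \<le> H\<^bsup>-\<eta>/m\<^esup>\<close> makes the sum over integer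
vectors converge.\<close>

lemma exponent_estimate:
  fixes Q H \<gamma> t \<eta> :: real
  assumes Q: "1 \<le> Q" "Q \<le> H" "H \<le> Q ^ m" and m: "m > 0"
    and \<eta>: "\<eta> = t * (1 + \<gamma> * (real d + 1)) - (real d + 2)" "\<eta> \<ge> 0" and \<gamma>t: "\<gamma> * t \<ge> 1"
  shows "Q ^ (d + 1) * ((H powr - \<gamma> * Q powr - (\<gamma> * real d)) / Q) powr t \<le> H powr - (1 + \<eta> / real m)"
proof -
  define h where "h = ln H"
  define l where "l = ln Q"
  have Q0: "Q > 0" "H > 0" using Q by auto
  have H: "H = exp h" and Qe: "Q = exp l" using Q0 by (simp_all add: h_def l_def)
  have l: "0 \<le> l" "l \<le> h" using Q Q0 by (simp_all add: h_def l_def)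
  have "h \<le> ln (Q ^ m)" using Q Q0 by (simp add: h_def)
  then have hm: "h \<le> real m * l" using Q0 by (simp add: l_def ln_realpow)
  have "(H powr - \<gamma> * Q powr - (\<gamma> * real d)) / Q = exp (- \<gamma> * h - \<gamma> * real d * l - l)"
    unfolding H Qe by (simp add: powr_def exp_diff exp_minus field_simps exp_add)
  then have "((H powr - \<gamma> * Q powr - (\<gamma> * real d)) / Q) powr t = exp (t * (- \<gamma> * h - \<gamma> * real d * l - l))"
    by (simp add: powr_def)
  moreover have "Q ^ (d + 1) = exp (real (d + 1) * l)" unfolding Qe by (rule exp_of_nat_mult[symmetric])
  ultimately have lhs: "Q ^ (d + 1) * ((H powr - \<gamma> * Q powr - (\<gamma> * real d)) / Q) powr t
      = exp (real (d + 1) * l + t * (- \<gamma> * h - \<gamma> * real d * l - l))"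
    by (simp only: exp_add)
  have "real (d + 1) * l + t * (- \<gamma> * h - \<gamma> * real d * l - l) = (\<gamma> * t - 1) * l - \<eta> * l - \<gamma> * t * h"
    unfolding \<eta>(1) by (simp add: algebra_simps)
  also have "\<dots> \<le> (\<gamma> * t - 1) * h - \<eta> * (h / real m) - \<gamma> * t * h"
  proof -
    have "(\<gamma> * t - 1) * l \<le> (\<gamma> * t - 1) * h" using \<gamma>t l by (intro mult_left_mono) auto
    moreover have "h / real m \<le> l" using hm m by (simp add: divide_le_eq mult.commute)
    then have "\<eta> * (h / real m) \<le> \<eta> * l" using \<eta>(2) by (rule mult_left_mono)
    ultimately show ?thesis by linarith
  qed
  also have "\<dots> = - (1 + \<eta> / real m) * h" by (simp add: algebra_simps)
  finally show ?thesis unfolding lhs unfolding H by (simp add: powr_def)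
qed

lemma finite_max_abs_le: "finite {q :: int^'r. max_abs q \<le> R}"
proof (rule finite_subset)
  show "{q :: int^'r. max_abs q \<le> R} \<subseteq> {q. \<forall>j. \<bar>of_int (q $ j) - (0 :: real^'r) $ j\<bar> \<le> \<bar>R\<bar>}"
  proof safe
    fix q :: "int^'r" and j assume "max_abs q \<le> R"
    then show "\<bar>of_int (q $ j) - (0 :: real^'r) $ j\<bar> \<le> \<bar>R\<bar>"
      using max_abs_ge[of q j] by simp
  qed
  show "finite {q :: int^'r. \<forall>j. \<bar>of_int (q $ j) - (0 :: real^'r) $ j\<bar> \<le> \<bar>R\<bar>}"
    by (rule card_int_vec_near(1)) simp
qed

text \<open>The contribution of one integer vector to the Hausdorff sum: the number of matrix cells of mesh
\<open>\<delta>\<close> is at most the \<open>(d + 1)\<close>-st power of the number of column cells, of order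
\<open>\<bar>q\<bar>\<^bsup>d+1\<^esup> \<delta>\<^bsup>-M\<^esup>\<close>, so the volume exponent \<open>M\<close> cancels and only \<open>t\<close> matters.\<close>

lemma cells_powr_bound:
  fixes q :: "int^'r" and \<gamma> t \<eta> :: real
  assumes N: "CARD('c) = d + 1" and \<gamma>: "\<gamma> \<ge> 1" and Q: "max_abs q \<ge> 1"
    and \<eta>: "\<eta> = t * (1 + \<gamma> * (real d + 1)) - (real d + 2)" "\<eta> \<ge> 0" and \<gamma>t: "\<gamma> * t \<ge> 1"
  defines "\<delta> \<equiv> approx_radius d \<gamma> q / max_abs q"
  defines "M \<equiv> (CARD('r) - 1) * CARD('c)"
  shows "real (card {K::int^'c^'r. \<forall>j. column j K \<in> near_integer_cells q (approx_radius d \<gamma> q) \<delta>})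
      * \<delta> powr (t + real M)
    \<le> ((2 * real CARD('r) + 3) ^ 2 * 2 ^ (CARD('r) - 1)) ^ CARD('c) * height q powr - (1 + \<eta> / real CARD('r))"
proof -
  let ?m = "CARD('r)" and ?N = "CARD('c)" and ?Q = "max_abs q"
  let ?S = "near_integer_cells q (approx_radius d \<gamma> q) \<delta>"
  have \<psi>: "0 < approx_radius d \<gamma> q" "approx_radius d \<gamma> q \<le> 1"
    using approx_radius_bounds[OF Q] \<gamma> by auto
  have \<delta>0: "\<delta> > 0" using \<psi> Q by (simp add: \<delta>_def)
  have "real (card {K::int^'c^'r. \<forall>j. column j K \<in> ?S}) \<le> real (card ?S) ^ ?N"
    using card_matrix_cells(2)[OF card_near_integer_cells(1)[OF Q \<psi> \<delta>_def[THEN meta_eq_to_obj_eq]], where 'c = 'c]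
    by (simp flip: of_nat_power)
  also have "\<dots> \<le> ((2 * real ?m + 3) ^ 2 * ?Q * (2 / \<delta>) ^ (?m - 1)) ^ ?N"
    by (intro power_mono card_near_integer_cells(2)[OF Q \<psi> \<delta>_def[THEN meta_eq_to_obj_eq]]) simp
  also have "\<dots> = ((2 * real ?m + 3) ^ 2 * 2 ^ (?m - 1)) ^ ?N * (?Q ^ ?N * (1 / \<delta> ^ M))"
    unfolding M_def by (simp add: power_mult_distrib power_divide power_mult[symmetric])
  finally have card: "real (card {K::int^'c^'r. \<forall>j. column j K \<in> ?S})
      \<le> ((2 * real ?m + 3) ^ 2 * 2 ^ (?m - 1)) ^ ?N * (?Q ^ ?N * (1 / \<delta> ^ M))" .
  have "real (card {K::int^'c^'r. \<forall>j. column j K \<in> ?S}) * \<delta> powr (t + real M)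
      \<le> ((2 * real ?m + 3) ^ 2 * 2 ^ (?m - 1)) ^ ?N * (?Q ^ ?N * (1 / \<delta> ^ M)) * \<delta> powr (t + real M)"
    by (rule mult_right_mono[OF card]) simp
  also have "\<dots> = ((2 * real ?m + 3) ^ 2 * 2 ^ (?m - 1)) ^ ?N * (?Q ^ (d + 1) * \<delta> powr t)"
    using \<delta>0 by (simp add: powr_add powr_realpow N)
  also have "\<dots> \<le> ((2 * real ?m + 3) ^ 2 * 2 ^ (?m - 1)) ^ ?N * height q powr - (1 + \<eta> / real ?m)"
    unfolding \<delta>_def approx_radius_def
    by (intro mult_left_mono exponent_estimate[OF Q max_abs_le_height height_le_max_abs_power[OF Q] _ \<eta> \<gamma>t]) auto
  finally show ?thesis .
qed

text \<open>Each matrix in the set lies in a cell attached to some \<open>q\<close> of arbitrarily large norm. Half of the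
distance of \<open>s\<close> from the critical exponent is spent on convergence of the sum over all \<open>q\<close>, the other
half on a factor \<open>\<delta>\<^sup>e\<close>, which tends to 0 with the bound \<open>\<delta>\<close> on the diameters.\<close>

lemma hausdorff_measure_approximable_zero:
  fixes s \<gamma> :: real
  assumes N: "CARD('c) = d + 1" and \<gamma>: "\<gamma> \<ge> 1"
    and s: "s > (real d + 1) * (real CARD('r) - 1) + (real d + 2) / (1 + \<gamma> * (real d + 1))"
  shows "hausdorff_measure s (approximable_matrices d \<gamma> :: (real^'c^'r) set) = 0"
proof -
  let ?m = "CARD('r)" and ?N = "CARD('c)"
  define M where "M = (?m - 1) * ?N"
  have M: "real M = (real d + 1) * (real ?m - 1)"
  proof -
    have "real (?m - 1) = real ?m - 1" by (simp add: of_nat_diff Suc_leI)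
    then show ?thesis unfolding M_def of_nat_mult N by (simp add: mult.commute)
  qed
  define t0 where "t0 = (real d + 2) / (1 + \<gamma> * (real d + 1))"
  define e where "e = (s - (real M + t0)) / 2"
  define t where "t = t0 + e"
  have e: "e > 0" using s M by (simp add: e_def t0_def)
  have s_eq: "s = e + (t + real M)" by (simp add: t_def e_def)
  have den: "1 + \<gamma> * (real d + 1) > 0" using \<gamma> by (simp add: add_pos_nonneg)
  define \<eta> where "\<eta> = t * (1 + \<gamma> * (real d + 1)) - (real d + 2)"
  have \<eta>: "\<eta> > 0"
  proof -
    have "t0 * (1 + \<gamma> * (real d + 1)) = real d + 2" using den by (simp add: t0_def)
    then have "\<eta> = e * (1 + \<gamma> * (real d + 1))" by (simp add: \<eta>_def t_def distrib_right)
    then show ?thesis using e den by simp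
  qed
  have \<gamma>t: "\<gamma> * t \<ge> 1"
  proof -
    have "1 \<le> \<gamma> * t0" using den \<gamma> by (simp add: t0_def le_divide_eq algebra_simps)
    also have "\<dots> \<le> \<gamma> * t" using \<gamma> e by (intro mult_left_mono) (auto simp: t_def)
    finally show ?thesis .
  qed
  have t: "t > 0" using \<gamma>t \<gamma> by (smt (verit) mult_nonneg_nonpos)
  define a where "a = 1 + \<eta> / real ?m"
  have "a > 1" using \<eta> by (simp add: a_def)
  then obtain Z where Z: "Z \<ge> 0" "\<And>F. finite F \<Longrightarrow> (\<Sum>q\<in>F. height (q :: int^'r) powr - a) \<le> Z"
    using height_sum_bounded[of a] by blast
  define C0 where "C0 = ((2 * real ?m + 3) ^ 2 * 2 ^ (?m - 1)) ^ ?N"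
  define L where "L = real ?m * real ?N"
  define C1 where "C1 = L powr (t + real M) * C0"
  have C1: "C1 \<ge> 0" by (simp add: C1_def C0_def)
  have L: "L > 0" by (simp add: L_def)
  let ?\<psi> = "\<lambda>q :: int^'r. approx_radius d \<gamma> q"
  define D where "D q = ?\<psi> q / max_abs q" for q :: "int^'r"
  define cells where "cells q = {K::int^'c^'r. \<forall>j. column j K \<in> near_integer_cells q (?\<psi> q) (D q)}" for q :: "int^'r"
  have \<psi>: "0 < ?\<psi> q" "?\<psi> q \<le> 1" if "max_abs q \<ge> 1" for q :: "int^'r"
    using approx_radius_bounds[OF that] \<gamma> by auto
  have D0: "D q > 0" if "max_abs q \<ge> 1" for q using \<psi>[OF that] that by (simp add: D_def)
  have fin_cells: "finite (cells q)" if "max_abs q \<ge> 1" for q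
    unfolding cells_def by (intro card_matrix_cells(1) card_near_integer_cells(1)[OF that \<psi>[OF that]]) (simp add: D_def)
  show ?thesis
  proof (rule hausdorff_measure_zeroI[OF e])
    show "C1 * Z \<ge> 0" using C1 Z by simp
    fix \<delta> :: real assume \<delta>: "\<delta> > 0"
    \<comment> \<open>Only integer vectors whose cells have diameter at most \<open>\<delta>\<close> are used; this excludes finitely many.\<close>
    define good where "good q \<longleftrightarrow> max_abs q \<ge> 1 \<and> L * D q \<le> \<delta>" for q :: "int^'r"
    define U where "U = (\<lambda>(q, K). if good q \<and> K \<in> cells q then matrix_cell (D q) K else {})"
    have each: "real (card (cells q)) * (L * D q) powr s \<le> C1 * \<delta> powr e * height q powr - a" if "good q" for q
    proof -
      have q: "max_abs q \<ge> 1" "L * D q \<le> \<delta>" using that by (auto simp: good_def)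
      have LD: "L * D q > 0" using L D0[OF q(1)] by simp
      have "(L * D q) powr s = (L * D q) powr e * (L powr (t + real M) * D q powr (t + real M))"
        unfolding s_eq powr_add[of _ e] using L D0[OF q(1)] by (simp add: powr_mult)
      also have "\<dots> \<le> \<delta> powr e * (L powr (t + real M) * D q powr (t + real M))"
        using q LD e by (intro mult_right_mono powr_mono2) auto
      finally have "real (card (cells q)) * (L * D q) powr s
          \<le> real (card (cells q)) * (\<delta> powr e * (L powr (t + real M) * D q powr (t + real M)))"
        by (rule mult_left_mono) simp
      also have "\<dots> = \<delta> powr e * L powr (t + real M) * (real (card (cells q)) * D q powr (t + real M))"
        by (simp add: mult_ac)
      also have "\<dots> \<le> \<delta> powr e * L powr (t + real M) * (C0 * height q powr - a)"
        unfolding cells_def D_def C0_def a_def M_def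
        by (intro mult_left_mono cells_powr_bound[OF N \<gamma> q(1) \<eta>_def less_imp_le[OF \<eta>] \<gamma>t]) auto
      also have "\<dots> = C1 * \<delta> powr e * height q powr - a" by (simp add: C1_def mult_ac)
      finally show ?thesis .
    qed
    show "hausdorff_premeasure s \<delta> (approximable_matrices d \<gamma> :: (real^'c^'r) set) \<le> ennreal (C1 * Z * \<delta> powr e)"
    proof (rule hausdorff_premeasure_le)
      show "bounded (U x)" for x
        by (cases x) (auto simp: U_def good_def intro: matrix_cell_diameter D0)
      have diam_le: "diameter (U (q, K)) \<le> L * D q" if "good q" for q K
        using matrix_cell_diameter(2)[OF D0, of q K] that L D0[of q] by (auto simp: U_def good_def L_def less_imp_le)
      show "diameter (U x) \<le> \<delta>" for x
        using diam_le[of "fst x" "snd x"] \<delta> by (cases "good (fst x)") (auto simp: good_def U_def case_prod_unfold)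
      show "\<delta> \<ge> 0" using \<delta> by simp
      show "approximable_matrices d \<gamma> \<subseteq> (\<Union>x. U x)"
      proof
        fix A :: "real^'c^'r" assume A: "A \<in> approximable_matrices d \<gamma>"
        have "\<exists>q. q \<in> {q. \<exists>\<sigma>\<^sub>1 \<sigma>\<^sub>2. max_abs q = height q powr \<sigma>\<^sub>2 \<and> \<sigma>\<^sub>1 = \<gamma> * (1 + real d * \<sigma>\<^sub>2) \<and>
              Max (range (\<lambda>j. dist_nearest_int ((\<chi> i. real_of_int (q $ i)) \<bullet> column j A))) < height q powr - \<sigma>\<^sub>1}
            - {q. max_abs q \<le> L / \<delta>}"
          using infinite_imp_nonempty[OF Diff_infinite_finite[OF finite_max_abs_le]] A
          unfolding approximable_matrices_def by blast
        then obtain q \<sigma>\<^sub>1 \<sigma>\<^sub>2 where q: "max_abs q = height q powr \<sigma>\<^sub>2" "\<sigma>\<^sub>1 = \<gamma> * (1 + real d * \<sigma>\<^sub>2)"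
          and near: "Max (range (\<lambda>j. dist_nearest_int ((\<chi> i. real_of_int (q $ i)) \<bullet> column j A))) < height q powr - \<sigma>\<^sub>1"
          and large: "max_abs q > L / \<delta>" by auto
        note q1 = approx_radius_eq[OF q]
        have "D q \<le> 1 / max_abs q" unfolding D_def using \<psi>[OF q1(1)] q1(1) by (intro divide_right_mono) auto
        then have "L * D q \<le> L * (1 / max_abs q)" using L by (intro mult_left_mono) auto
        also have "\<dots> \<le> \<delta>" using large \<delta> q1(1) by (simp add: field_simps)
        finally have good: "good q" using q1(1) by (simp add: good_def)
        define K where "K = ((\<chi> i. \<chi> j. \<lfloor>A $ i $ j / D q\<rfloor>) :: int^'c^'r)"
        have "column j K \<in> near_integer_cells q (?\<psi> q) (D q)" for j
        proof -
          have "dist_nearest_int ((\<chi> i. real_of_int (q $ i)) \<bullet> column j A) < ?\<psi> q"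
            using near q1(2) by (subst (asm) Max_less_iff) auto
          moreover have "(\<chi> i. real_of_int (q $ i)) \<bullet> column j A = (\<Sum>i\<in>UNIV. of_int (q $ i) * A $ i $ j)"
            by (simp add: inner_vec_def column_def)
          ultimately show ?thesis
            using A unfolding near_integer_cells_def approximable_matrices_def
            by (auto simp: K_def column_def intro!: exI[of _ "\<lambda>i. A $ i $ j"])
        qed
        then have "A \<in> U (q, K)" using good by (simp add: U_def cells_def matrix_cell_def K_def)
        then show "A \<in> (\<Union>x. U x)" by blast
      qed
      fix F :: "((int^'r) \<times> (int^'c^'r)) set" assume F: "finite F"
      let ?f = "\<lambda>q K. if good q \<and> K \<in> cells q then ennreal ((L * D q) powr s) else 0"
      have s0: "s > 0" using s_eq e t by simp
      have "diam_power s (U x) \<le> ?f (fst x) (snd x)" for x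
      proof (cases "U x = {}")
        case False
        then have x: "good (fst x)" "snd x \<in> cells (fst x)"
          by (auto simp: U_def case_prod_unfold split: if_splits)
        have "bounded (U x)"
          by (cases x) (auto simp: U_def good_def intro: matrix_cell_diameter D0)
        then have "diameter (U x) powr s \<le> (L * D (fst x)) powr s"
          using diam_le[OF x(1), of "snd x"] s0 by (intro powr_mono2) (auto simp: diameter_ge_0)
        then show ?thesis using x False s0 by (simp add: diam_power_def ennreal_leI)
      qed (simp add: diam_power_def)
      then have "(\<Sum>x\<in>F. diam_power s (U x)) \<le> (\<Sum>x\<in>F. ?f (fst x) (snd x))" by (rule sum_mono)
      also have "\<dots> \<le> (\<Sum>x\<in>fst ` F \<times> snd ` F. ?f (fst x) (snd x))"
        using F by (intro sum_mono2) (auto intro: rev_image_eqI)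
      also have "\<dots> = (\<Sum>q\<in>fst ` F. \<Sum>K\<in>snd ` F. ?f q K)"
        by (simp add: sum.cartesian_product case_prod_unfold)
      also have "\<dots> \<le> (\<Sum>q\<in>fst ` F. ennreal (C1 * \<delta> powr e * height q powr - a))"
      proof (rule sum_mono)
        fix q
        show "(\<Sum>K\<in>snd ` F. ?f q K) \<le> ennreal (C1 * \<delta> powr e * height q powr - a)"
        proof (cases "good q")
          case True
          then have fin: "finite (cells q)" using fin_cells by (simp add: good_def)
          have "(\<Sum>K\<in>snd ` F. ?f q K) = (\<Sum>K\<in>snd ` F \<inter> cells q. ennreal ((L * D q) powr s))"
            using F True by (intro sum.mono_neutral_cong_right) auto
          also have "\<dots> \<le> (\<Sum>K\<in>cells q. ennreal ((L * D q) powr s))"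
            using fin by (intro sum_mono2) auto
          also have "\<dots> = ennreal (real (card (cells q)) * (L * D q) powr s)"
            by (simp add: ennreal_of_nat_eq_real_of_nat ennreal_mult)
          also have "\<dots> \<le> ennreal (C1 * \<delta> powr e * height q powr - a)" by (rule ennreal_leI[OF each[OF True]])
          finally show ?thesis .
        qed simp
      qed
      also have "\<dots> = ennreal (\<Sum>q\<in>fst ` F. C1 * \<delta> powr e * height q powr - a)"
        using C1 by (intro sum_ennreal) auto
      also have "\<dots> = ennreal (C1 * \<delta> powr e * (\<Sum>q\<in>fst ` F. height q powr - a))"
        by (simp add: sum_distrib_left)
      also have "\<dots> \<le> ennreal (C1 * \<delta> powr e * Z)"
        using C1 F by (intro ennreal_leI mult_left_mono Z(2)) auto
      finally show "(\<Sum>x\<in>F. diam_power s (U x)) \<le> ennreal (C1 * Z * \<delta> powr e)" by (simp add: mult_ac)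
    qed
  qed
qed

section \<open>The Hausdorff dimension\<close>

lemma suminf_half_powers: "(\<Sum>i. ennreal (\<eta> * (1 / 2) ^ Suc i)) = ennreal \<eta>" if "\<eta> \<ge> 0"
proof -
  have "(\<lambda>i. \<eta> * (1 / 2) ^ Suc i) sums (\<eta> * 1)" by (rule sums_mult[OF power_half_series])
  then show ?thesis using that by (intro sums_unique[symmetric] sums_ennreal[THEN iffD2]) auto
qed

text \<open>If \<open>s\<close> were smaller, choose \<open>u\<close> strictly between \<open>s\<close> and the critical exponent, and above
the number \<open>M\<close> of free entries. A cover with tiny sum of \<open>s\<close>-th powers and diameters at most 1 has a tiny sum of \<open>u\<close>-th powers, which
contradicts the lower bound for covers.\<close>

lemma hausdorff_measure_approximable_zero_imp:
  fixes s \<gamma> :: real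
  assumes N: "CARD('c) = d + 1" and d: "d \<ge> 1" and \<gamma>: "\<gamma> \<ge> 1" and s: "s \<ge> 0"
    and zero: "hausdorff_measure s (approximable_matrices d \<gamma> :: (real^'c^'r) set) = 0"
  shows "(real d + 1) * (real CARD('r) - 1) + (real d + 2) / (1 + \<gamma> * (real d + 1)) \<le> s"
proof (rule ccontr)
  assume neg: "\<not> ?thesis"
  let ?m = "CARD('r)" and ?N = "CARD('c)"
  define M where "M = (?m - 1) * ?N"
  have M: "real M = (real d + 1) * (real ?m - 1)"
  proof -
    have "real (?m - 1) = real ?m - 1" by (simp add: of_nat_diff Suc_leI)
    then show ?thesis unfolding M_def of_nat_mult N by (simp add: mult.commute)
  qed
  define t0 where "t0 = (real ?N + 1) / (1 + \<gamma> * (1 + real d))"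
  have t0: "t0 > 0" using \<gamma> by (simp add: t0_def add_pos_nonneg)
  have s_less: "s < real M + t0" using neg unfolding M t0_def N by (simp add: add.commute)
  define u where "u = (max s (real M) + (real M + t0)) / 2"
  have u: "s < u" "real M < u" "u < real M + t0" using s_less t0 by (auto simp: u_def max_def)
  define t where "t = u - real M"
  have t: "0 < t" "t < (real ?N + 1) / (1 + \<gamma> * (1 + real d))" using u by (auto simp: t_def t0_def)
  have u0: "u > 0" using u s by linarith
  define c where "c = 1 / (4 * 48 ^ ?N) * (1 / 2) powr t / 2 ^ M"
  define \<eta> where "\<eta> = c / 4"
  have c: "c > 0" by (simp add: c_def)
  then have \<eta>: "\<eta> > 0" by (simp add: \<eta>_def)
  have "hausdorff_premeasure s 1 (approximable_matrices d \<gamma> :: (real^'c^'r) set)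
      \<le> hausdorff_measure s (approximable_matrices d \<gamma> :: (real^'c^'r) set)"
    unfolding hausdorff_measure_def by (rule SUP_upper) simp
  then have "hausdorff_premeasure s 1 (approximable_matrices d \<gamma> :: (real^'c^'r) set) < ennreal \<eta>"
    using zero \<eta> by simp
  then obtain V :: "nat \<Rightarrow> (real^'c^'r) set" where V: "approximable_matrices d \<gamma> \<subseteq> (\<Union>i. V i)"
    and bd: "\<And>i. bounded (V i)" and diam: "\<And>i. diameter (V i) \<le> 1"
    and sum: "(\<Sum>i. diam_power s (V i)) < ennreal \<eta>"
    unfolding hausdorff_premeasure_def INF_less_iff by auto
  \<comment> \<open>Sets of diameter 0 get a positive radius, at a total cost of \<open>\<eta>\<close>.\<close>
  define r where "r i = max (diameter (V i)) ((\<eta> * (1 / 2) ^ Suc i) powr (1 / u))" for i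
  have r: "diameter (V i) \<le> r i" "r i > 0" for i using \<eta> by (auto simp: r_def less_max_iff_disj)
  have each: "ennreal (r i powr u) \<le> diam_power s (V i) + ennreal (\<eta> * (1 / 2) ^ Suc i)" for i
  proof (cases "r i = diameter (V i)")
    case True
    have "V i \<noteq> {}" using r(2)[of i] True by auto
    moreover have "ennreal (r i powr u) \<le> diam_power s (V i)"
    proof (cases "s = 0")
      case True
      then show ?thesis using \<open>V i \<noteq> {}\<close> diam[of i] r(2)[of i] \<open>r i = diameter (V i)\<close> u0
        by (simp add: diam_power_def powr_le1)
    next
      case False
      have "r i powr u \<le> r i powr s"
        using u(1) r(2)[of i] diam[of i] True by (intro powr_mono') auto
      then show ?thesis using False \<open>V i \<noteq> {}\<close> True by (simp add: diam_power_def ennreal_leI)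
    qed
    ultimately show ?thesis by (simp add: add_increasing2)
  next
    case False
    then have "r i = (\<eta> * (1 / 2) ^ Suc i) powr (1 / u)" by (auto simp: r_def max_def split: if_splits)
    then have "r i powr u = \<eta> * (1 / 2) ^ Suc i" using u0 \<eta> by (simp add: powr_powr)
    then show ?thesis by (simp only:) (rule add_increasing, simp_all)
  qed
  have "ennreal c \<le> (\<Sum>i. ennreal (r i powr (t + real M)))"
    unfolding c_def M_def by (rule cover_sum_lower_bound[OF N d \<gamma> t V bd r])
  also have "\<dots> = (\<Sum>i. ennreal (r i powr u))" by (simp add: t_def)
  also have "\<dots> \<le> (\<Sum>i. diam_power s (V i) + ennreal (\<eta> * (1 / 2) ^ Suc i))"
    by (intro suminf_le each summableI)
  also have "\<dots> = (\<Sum>i. diam_power s (V i)) + (\<Sum>i. ennreal (\<eta> * (1 / 2) ^ Suc i))"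
    by (rule suminf_add[symmetric]) (rule summableI)+
  also have "\<dots> = (\<Sum>i. diam_power s (V i)) + ennreal \<eta>"
    by (simp only: suminf_half_powers[OF less_imp_le[OF \<eta>]])
  also have "\<dots> \<le> ennreal \<eta> + ennreal \<eta>" using sum by (intro add_right_mono) auto
  also have "\<dots> = ennreal (\<eta> + \<eta>)" using \<eta> by (intro ennreal_plus[symmetric]) auto
  finally have "c \<le> \<eta> + \<eta>" using \<eta> by (subst (asm) ennreal_le_iff) auto
  then show False using c by (simp add: \<eta>_def)
qed

theorem lemma3p7:
  fixes d n :: nat and \<gamma> :: real and W :: "(real^'c^'r) set"
  assumes "1 \<le> d" and "d < n"
    and "CARD('r) = n - d" and "CARD('c) = d + 1"
    and "\<gamma> \<ge> 1"
    and "W = approximable_matrices d \<gamma>"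
  shows "hausdorff_dim W =
           ereal ((real d + 1) * (real n - real d - 1) + (real d + 2) / (1 + \<gamma> * (real d + 1)))
       \<and> (real d + 1) * (real n - real d - 1) + (real d + 2) / (1 + \<gamma> * (real d + 1))
           \<le> (real n - real d) * (real d + 1) - real d"
proof
  let ?s0 = "(real d + 1) * (real n - real d - 1) + (real d + 2) / (1 + \<gamma> * (real d + 1))"
  have m: "real CARD('r) = real n - real d" using assms by (simp add: of_nat_diff)
  have den: "real d + 2 \<le> 1 + \<gamma> * (real d + 1)"
    using mult_right_mono[of 1 \<gamma> "real d + 1"] assms(5) by (simp add: algebra_simps)
  have s0: "?s0 \<ge> 0" using assms(2,5) by (intro add_nonneg_nonneg mult_nonneg_nonneg divide_nonneg_nonneg) auto
  show "hausdorff_dim W = ereal ?s0"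
    unfolding hausdorff_dim_def
  proof (rule antisym)
    show "Inf {ereal s |s. 0 \<le> s \<and> hausdorff_measure s W = 0} \<le> ereal ?s0"
    proof (rule ereal_le_epsilon2)
      fix \<epsilon> :: real assume "0 < \<epsilon>"
      then have "hausdorff_measure (?s0 + \<epsilon>) W = 0"
        unfolding assms(6) using m by (intro hausdorff_measure_approximable_zero[OF assms(4,5)]) simp
      then show "Inf {ereal s |s. 0 \<le> s \<and> hausdorff_measure s W = 0} \<le> ereal ?s0 + ereal \<epsilon>"
        using s0 \<open>0 < \<epsilon>\<close> by (intro Inf_lower) auto
    qed
    show "ereal ?s0 \<le> Inf {ereal s |s. 0 \<le> s \<and> hausdorff_measure s W = 0}"
    proof (rule Inf_greatest)
      fix x assume "x \<in> {ereal s |s. 0 \<le> s \<and> hausdorff_measure s W = 0}"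
      then obtain s where x: "x = ereal s" "0 \<le> s" and zero: "hausdorff_measure s W = 0" by auto
      show "ereal ?s0 \<le> x"
        using hausdorff_measure_approximable_zero_imp[OF assms(4,1,5) x(2) zero[unfolded assms(6)]] m
        unfolding x(1) by simp
    qed
  qed
  have "(real d + 2) / (1 + \<gamma> * (real d + 1)) \<le> 1" using den by (simp add: divide_le_eq)
  then show "?s0 \<le> (real n - real d) * (real d + 1) - real d" by (simp add: algebra_simps)
qed

end
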